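(* Let $n\ge 2$ be an integer. There is a constant $C_n$ such that for every integer $q\ge 2$ and every $x\in\mathrm{SL}_n(\mathbb{Z}/q\mathbb{Z})$ there is $\gamma\in\mathrm{SL}_n(\mathbb{Z})$ with $\pi_q(\gamma)=x$ and $\|\gamma\|\le C_n q^2\log q$.
   Context: $\pi_q\colon\mathrm{SL}_n(\mathbb{Z})\to\mathrm{SL}_n(\mathbb{Z}/q\mathbb{Z})$ denotes reduction modulo $q$, and $\|\cdot\|$ denotes the operator norm of a matrix. *)

theory Defs
  imports "HOL-Analysis.Analysis" "HOL-Number_Theory.Residues"
begin

text \<open>
  \<^const>\<open>det\<close> needs a ring given by a type, so it does not apply to matrices over
  \<open>\<int>/q\<int>\<close> for a variable \<open>q\<close>. Hence the Leibniz formula for a ring \<open>R\<close> in the sense of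
  HOL-Algebra; the square matrices over \<open>R\<close> are those with all entries in \<^term>\<open>carrier R\<close>.
\<close>

definition det_over :: "('a, 'm) ring_scheme \<Rightarrow> 'a ^ 'n ^ 'n \<Rightarrow> 'a" where
  "det_over R A =
    (\<Oplus>\<^bsub>R\<^esub>p\<in>{p. p permutes (UNIV :: 'n::finite set)}.
      (if evenperm p then \<one>\<^bsub>R\<^esub> else \<ominus>\<^bsub>R\<^esub> \<one>\<^bsub>R\<^esub>) \<otimes>\<^bsub>R\<^esub> (\<Otimes>\<^bsub>R\<^esub>i\<in>UNIV. A $ i $ p i))"

definition SL_over :: "('a, 'm) ring_scheme \<Rightarrow> ('a ^ 'n ^ 'n::finite) set" where
  "SL_over R = {A. (\<forall>i j. A $ i $ j \<in> carrier R) \<and> det_over R A = \<one>\<^bsub>R\<^esub>}"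

definition SL_int :: "(int ^ 'n ^ 'n::finite) set" where
  "SL_int = {A. det A = 1}"

text \<open>
  Reduction modulo \<open>q\<close>. The elements of \<^term>\<open>residue_ring q\<close>, the library's \<open>\<int>/q\<int>\<close>,
  are the representatives \<open>0, \<dots>, q - 1\<close>.
\<close>

definition reduce_mod :: "int \<Rightarrow> int ^ 'n ^ 'n \<Rightarrow> int ^ 'n ^ 'n::finite" where
  "reduce_mod q = map_matrix (\<lambda>a. a mod q)"

definition op_norm :: "int ^ 'n ^ 'n::finite \<Rightarrow> real" where
  "op_norm A = onorm ((*v) (map_matrix real_of_int A))"

lemma det_over_residue_ring:
  fixes A :: "int ^ 'n ^ 'n::finite"
  assumes "q \<ge> 2"
  shows "det_over (residue_ring q) (reduce_mod q A) = det A mod q"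
proof -
  interpret residues q "residue_ring q"
    using assms by unfold_locales auto
  have s: "(if evenperm p then \<one>\<^bsub>residue_ring q\<^esub> else \<ominus>\<^bsub>residue_ring q\<^esub> \<one>\<^bsub>residue_ring q\<^esub>)
      = sign p mod q" for p :: "'n \<Rightarrow> 'n"
    by (simp add: sign_def one_cong neg_cong)
  have "(if evenperm p then \<one>\<^bsub>residue_ring q\<^esub> else \<ominus>\<^bsub>residue_ring q\<^esub> \<one>\<^bsub>residue_ring q\<^esub>)
      \<otimes>\<^bsub>residue_ring q\<^esub> (\<Otimes>\<^bsub>residue_ring q\<^esub>i\<in>UNIV. reduce_mod q A $ i $ p i)
      = (sign p * (\<Prod>i\<in>UNIV. A $ i $ p i)) mod q" for p :: "'n \<Rightarrow> 'n"
    unfolding s by (simp add: reduce_mod_def map_matrix_def prod_cong mult_cong)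
  then show ?thesis
    unfolding det_over_def det_def by (simp add: sum_cong finite_permutations)
qed

lemma reduce_mod_SL:
  assumes "q \<ge> 2" and "A \<in> SL_int"
  shows "reduce_mod q A \<in> SL_over (residue_ring q)"
  using assms det_over_residue_ring[of q A]
  by (auto simp: SL_int_def SL_over_def reduce_mod_def map_matrix_def residue_ring_def)

end

theory Submission
  imports Defs
begin

text \<open>
  Lift all rows of \<open>x\<close> but one to vectors \<open>x\<^sub>i + q w\<^sub>i\<close> with \<open>w\<^sub>i\<close> in the box \<open>[0, K)\<^sup>n\<close>, where
  \<open>K = O(log q)\<close>, so that the lifted rows are linearly independent modulo every prime. The rows
  are chosen one at a time. Since at most \<open>n - 2\<close> rows are already there, their span modulo \<open>p\<close>
  has codimension at least 2, so a prime \<open>p \<le> K\<close> not dividing \<open>q\<close> excludes a proportion of about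
  \<open>1/p\<^sup>2\<close> of the box, and these proportions add up to less than 1. A prime \<open>p > K\<close> excludes \<open>w\<close> only
  if it divides two linear forms in \<open>w\<close> with integer coefficients of size polynomial in \<open>q K\<close>
  (found by the pigeonhole principle); such forms have \<open>O(log q)\<close> prime divisors, so the large
  primes together exclude a proportion of \<open>O(log q / K)\<close>.

  The vector \<open>c\<close> of cofactors of the last row then has coprime entries, so some \<open>b\<close> makes the
  determinant with last row \<open>x\<^sub>n + q b\<close> equal to 1. Only the inner product of \<open>b\<close> with \<open>c\<close> matters,
  and \<open>c\<close> is orthogonal to the other rows, so \<open>b\<close> may be reduced modulo these: its component along
  \<open>c\<close> is bounded and the other part is at most the sum of their norms, which is \<open>O(q log q)\<close>.
\<close>

section \<open>Pigeonhole and counting lemmas\<close>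

text \<open>Serves twice: with \<open>r\<close> the reduction modulo \<open>p\<close>, and with
  \<open>r\<close> the identity. The difference of two colliding coefficient vectors annihilates the
  family, modulo \<open>p\<close> or exactly.\<close>

lemma linear_collision:
  fixes v :: "'i \<Rightarrow> 'j \<Rightarrow> int" and r :: "int \<Rightarrow> int"
  assumes S: "finite S" and T: "finite T" and R: "finite R"
    and r: "\<And>g i. g \<in> T \<rightarrow>\<^sub>E {0..<int H} \<Longrightarrow> i \<in> S \<Longrightarrow> r (\<Sum>j\<in>T. g j * v i j) \<in> R"
    and less: "card R ^ card S < H ^ card T"
  obtains g h where "g \<in> T \<rightarrow>\<^sub>E {0..<int H}" "h \<in> T \<rightarrow>\<^sub>E {0..<int H}" "\<exists>j\<in>T. g j \<noteq> h j"
    "\<And>i. i \<in> S \<Longrightarrow> r (\<Sum>j\<in>T. g j * v i j) = r (\<Sum>j\<in>T. h j * v i j)"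
proof -
  let ?G = "T \<rightarrow>\<^sub>E {0..<int H}"
  let ?f = "\<lambda>g. \<lambda>i\<in>S. r (\<Sum>j\<in>T. g j * v i j)"
  have "card (?f ` ?G) \<le> card (S \<rightarrow>\<^sub>E R)"
    using r by (intro card_mono finite_PiE S R) auto
  also have "\<dots> < card ?G"
    using less S T by (simp add: card_PiE)
  finally have "\<not> inj_on ?f ?G"
    by (rule pigeonhole)
  then obtain g h where gh: "g \<in> ?G" "h \<in> ?G" "g \<noteq> h" "?f g = ?f h"
    by (auto simp: inj_on_def)
  show thesis
  proof (rule that[OF gh(1,2)])
    show "\<exists>j\<in>T. g j \<noteq> h j"
      using gh(1-3) by (meson PiE_ext)
    show "r (\<Sum>j\<in>T. g j * v i j) = r (\<Sum>j\<in>T. h j * v i j)" if "i \<in> S" for i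
      using fun_cong[OF gh(4), of i] that by simp
  qed
qed

text \<open>There are \<open>p ^ card T\<close> coefficient vectors with entries in
  \<open>{0..<p}\<close> but only \<open>p ^ card S\<close> tuples of residues, and distinct
  elements of \<open>{0..<p}\<close> are incongruent.\<close>

lemma annihilator_mod:
  fixes v :: "'i \<Rightarrow> 'j \<Rightarrow> int" and p :: int
  assumes S: "finite S" and T: "finite T" and ST: "card S < card T" and p: "p \<ge> 2"
  obtains f where "\<And>i. i \<in> S \<Longrightarrow> p dvd (\<Sum>j\<in>T. f j * v i j)" "\<exists>j\<in>T. \<not> p dvd f j"
proof -
  have 1: "(\<lambda>x. x mod p) (\<Sum>j\<in>T. g j * v i j) \<in> {0..<p}" for g i
    using p by auto
  have 2: "card {0..<p} ^ card S < nat p ^ card T"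
    using p ST by simp
  obtain g h where gh: "g \<in> T \<rightarrow>\<^sub>E {0..<int (nat p)}" "h \<in> T \<rightarrow>\<^sub>E {0..<int (nat p)}"
      "\<exists>j\<in>T. g j \<noteq> h j"
      "\<And>i. i \<in> S \<Longrightarrow> (\<Sum>j\<in>T. g j * v i j) mod p = (\<Sum>j\<in>T. h j * v i j) mod p"
    by (rule linear_collision[where r = "\<lambda>x. x mod p" and v = v, OF S T _ 1 2]) blast+
  show thesis
  proof (rule that[of "\<lambda>j. g j - h j"])
    show "p dvd (\<Sum>j\<in>T. (g j - h j) * v i j)" if "i \<in> S" for i
      using gh(4)[OF that] by (simp add: left_diff_distrib sum_subtractf mod_eq_dvd_iff)
    obtain j where j: "j \<in> T" "g j \<noteq> h j"
      using gh(3) by auto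
    then have "g j \<in> {0..<p}" "h j \<in> {0..<p}"
      using gh(1,2) p by (auto dest: PiE_mem)
    then have "\<not> p dvd g j - h j"
      using j(2) by (metis atLeastLessThan_iff mod_eq_dvd_iff mod_pos_pos_trivial)
    then show "\<exists>j\<in>T. \<not> p dvd g j - h j"
      using j(1) by blast
  qed
qed

lemma abs_sum_mult_le:
  fixes f g :: "'a \<Rightarrow> int"
  assumes "\<And>j. j \<in> T \<Longrightarrow> \<bar>f j\<bar> \<le> A" "\<And>j. j \<in> T \<Longrightarrow> \<bar>g j\<bar> \<le> B"
  shows "\<bar>\<Sum>j\<in>T. f j * g j\<bar> \<le> int (card T) * (A * B)"
proof -
  have "\<bar>\<Sum>j\<in>T. f j * g j\<bar> \<le> (\<Sum>j\<in>T. \<bar>f j * g j\<bar>)"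
    by (rule sum_abs)
  also have "\<dots> \<le> (\<Sum>j\<in>T. A * B)"
  proof (rule sum_mono)
    fix j assume "j \<in> T"
    then show "\<bar>f j * g j\<bar> \<le> A * B"
      using assms[of j] unfolding abs_mult by (intro mult_mono) (auto intro: order_trans[OF abs_ge_zero])
  qed
  finally show ?thesis by simp
qed

text \<open>Siegel's lemma with a crude exponent. A bound polynomial in \<open>B\<close> suffices,
  since later only its logarithm counts.\<close>

lemma small_annihilator:
  fixes v :: "'i \<Rightarrow> 'j \<Rightarrow> int" and B :: nat
  assumes S: "finite S" and T: "finite T" and ST: "card S < card T" and B: "B \<ge> 1"
    and vB: "\<And>i j. i \<in> S \<Longrightarrow> j \<in> T \<Longrightarrow> \<bar>v i j\<bar> \<le> int B"
  obtains f where "\<And>i. i \<in> S \<Longrightarrow> (\<Sum>j\<in>T. f j * v i j) = 0" "\<exists>j\<in>T. f j \<noteq> 0"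
    "\<And>j. j \<in> T \<Longrightarrow> \<bar>f j\<bar> \<le> (3 * int (card T) * int B) ^ card T"
proof -
  \<comment> \<open>With coefficients below \<open>H\<close> each sum takes at most
    \<open>3 * card T * B * H\<close> values, so there are fewer than
    \<open>H ^ (card S + 1)\<close> tuples of values once \<open>H\<close> exceeds
    \<open>(3 * card T * B) ^ card S\<close>.\<close>
  define H where "H = (3 * card T * B) ^ card T"
  define M where "M = int (card T * (H * B))"
  have TB: "card T * B \<ge> 1"
    using ST B by (simp add: Suc_leI)
  then have gt1: "3 * card T * B > 1"
    by linarith
  have H1: "H \<ge> 1"
    unfolding H_def using gt1 less_imp_le by (intro one_le_power) blast
  have 1: "(\<Sum>j\<in>T. g j * v i j) \<in> {-M..M}" if "g \<in> T \<rightarrow>\<^sub>E {0..<int H}" "i \<in> S" for g i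
  proof -
    have "\<bar>g j\<bar> \<le> int H" if "j \<in> T" for j
      using PiE_mem[OF \<open>g \<in> _\<close> that] by simp
    then have "\<bar>\<Sum>j\<in>T. g j * v i j\<bar> \<le> int (card T) * (int H * int B)"
      using vB[OF that(2)] by (intro abs_sum_mult_le) auto
    then show ?thesis
      unfolding M_def by auto
  qed
  have "card {-M..M} \<le> 3 * card T * B * H"
  proof -
    have "card T * B * H \<ge> 1"
      using mult_le_mono[OF TB H1] by simp
    moreover have "card {-int m..int m} = 2 * m + 1" for m
      by simp
    then have "card {-M..M} = 2 * (card T * (H * B)) + 1"
      unfolding M_def .
    then have "card {-M..M} = 2 * (card T * B * H) + 1"
      by (simp only: mult_ac)
    ultimately show ?thesis by linarith
  qed
  then have "card {-M..M} ^ card S \<le> (3 * card T * B) ^ card S * H ^ card S"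
    by (metis power_mono power_mult_distrib zero_le)
  also have "\<dots> < H * H ^ card S"
    proof (rule mult_strict_right_mono)
    show "(3 * card T * B) ^ card S < H"
      unfolding H_def by (rule power_strict_increasing[OF ST gt1])
  qed (use H1 in simp)
  also have "\<dots> \<le> H ^ card T"
    using power_increasing[of "Suc (card S)" "card T" H] ST H1 by simp
  finally have 2: "card {-M..M} ^ card S < H ^ card T" .
  obtain g h where gh: "g \<in> T \<rightarrow>\<^sub>E {0..<int H}" "h \<in> T \<rightarrow>\<^sub>E {0..<int H}"
      "\<exists>j\<in>T. g j \<noteq> h j"
      "\<And>i. i \<in> S \<Longrightarrow> (\<Sum>j\<in>T. g j * v i j) = (\<Sum>j\<in>T. h j * v i j)"
    by (rule linear_collision[where r = "\<lambda>x. x" and v = v, OF S T _ 1 2]) blast+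
  show thesis
  proof (rule that[of "\<lambda>j. g j - h j"])
    show "(\<Sum>j\<in>T. (g j - h j) * v i j) = 0" if "i \<in> S" for i
      using gh(4)[OF that] by (simp add: left_diff_distrib sum_subtractf)
    show "\<exists>j\<in>T. g j - h j \<noteq> 0"
      using gh(3) by auto
    have "(3 * int (card T) * int B) ^ card T = int H"
      by (simp add: H_def)
    moreover have "g j \<in> {0..<int H}" "h j \<in> {0..<int H}" if "j \<in> T" for j
      using gh(1,2) that by (auto dest: PiE_mem)
    ultimately show "\<bar>g j - h j\<bar> \<le> (3 * int (card T) * int B) ^ card T" if "j \<in> T" for j
      using that by fastforce
  qed
qed

text \<open>Setting coordinate \<open>j\<close> to 0 acts as the projection that forgets
  \<open>j\<close>; its fibres are the lines in direction \<open>j\<close>, and each meets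
  \<open>A\<close> in at most \<open>N\<close> points.\<close>

lemma card_le_by_fibres:
  fixes A :: "('n \<Rightarrow> int) set"
  assumes "finite A" and "\<And>w. w \<in> A \<Longrightarrow> card {t. w(j := t) \<in> A} \<le> N"
  shows "card A \<le> N * card ((\<lambda>w. w(j := 0)) ` A)"
proof -
  let ?r = "\<lambda>w :: 'n \<Rightarrow> int. w(j := 0)"
  have "card {a \<in> A. ?r a = y} \<le> N" if "y \<in> ?r ` A" for y
  proof -
    obtain w where w: "w \<in> A" "y = ?r w"
      using \<open>y \<in> ?r ` A\<close> by blast
    have "(\<lambda>a. a j) ` {a \<in> A. ?r a = y} \<subseteq> {t. w(j := t) \<in> A}"
    proof
      fix t assume "t \<in> (\<lambda>a. a j) ` {a \<in> A. ?r a = y}"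
      then obtain a where a: "a \<in> A" "?r a = y" "t = a j" by blast
      then have "w(j := t) = a"
        using w(2) by (metis fun_upd_triv fun_upd_upd)
      then show "t \<in> {t. w(j := t) \<in> A}"
        using a(1) by simp
    qed
    moreover have "inj_on (\<lambda>a. a j) {a \<in> A. ?r a = y}"
      by (rule inj_onI) (metis (mono_tags, lifting) fun_upd_triv fun_upd_upd mem_Collect_eq)
    moreover have "finite {t. w(j := t) \<in> A}"
    proof (rule finite_subset)
      show "{t. w(j := t) \<in> A} \<subseteq> (\<lambda>a. a j) ` A"
      proof
        fix t assume "t \<in> {t. w(j := t) \<in> A}"
        then show "t \<in> (\<lambda>a. a j) ` A"
          by (intro image_eqI[where x = "w(j := t)"]) auto
      qed
    qed (use assms(1) in simp)
    ultimately show ?thesis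
      using assms(2)[OF w(1)] by (meson card_inj_on_le order_trans)
  qed
  then show ?thesis
    using card_sum_le_nat_sum sum_bounded_above[of "?r ` A" "\<lambda>y. card {a \<in> A. ?r a = y}" N]
      sum.image_gen[OF assms(1), of "\<lambda>_. 1::nat" ?r] by (simp add: mult.commute)
qed

text \<open>Congruent elements are told apart by their quotients by \<open>p\<close>, which lie
  between 0 and \<open>int K div p\<close>.\<close>

lemma card_congruent_le:
  fixes p :: int and K :: nat
  assumes "p > 0" and "U \<subseteq> {0..<int K}" and "\<And>s t. s \<in> U \<Longrightarrow> t \<in> U \<Longrightarrow> p dvd s - t"
  shows "card U \<le> nat (int K div p) + 1"
proof -
  have "inj_on (\<lambda>t. t div p) U"
  proof (rule inj_onI)
    fix s t assume "s \<in> U" "t \<in> U" "s div p = t div p"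
    then show "s = t"
      using assms(3)[of s t] by (metis mod_eq_dvd_iff mult_div_mod_eq)
  qed
  moreover have "(\<lambda>t. t div p) ` U \<subseteq> {0..int K div p}"
  proof
    fix d assume "d \<in> (\<lambda>t. t div p) ` U"
    then obtain t where "t \<in> U" "d = t div p" by blast
    moreover have "t \<in> {0..<int K}"
      using assms(2) \<open>t \<in> U\<close> by blast
    ultimately show "d \<in> {0..int K div p}"
      using assms(1) by (simp add: pos_imp_zdiv_nonneg_iff zdiv_mono1)
  qed
  ultimately have "card U \<le> card {0..int K div p}"
    by (intro card_inj_on_le) auto
  then show ?thesis
    using assms(1) by (simp add: nat_add_distrib pos_imp_zdiv_nonneg_iff)
qed

text \<open>The product of the distinct prime divisors divides \<open>d\<close>, and each factor is
  at least 2.\<close>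

lemma card_prime_divisors_le:
  fixes d :: int
  assumes "d \<noteq> 0" and "\<bar>d\<bar> \<le> 2 ^ L"
  shows "finite {p. prime p \<and> p dvd d}" and "card {p. prime p \<and> p dvd d} \<le> L"
proof -
  have eq: "{p. prime p \<and> p dvd d} = prime_factors d"
    using assms(1) by (auto simp: prime_factors_dvd)
  then show "finite {p. prime p \<and> p dvd d}" by simp
  have "(2::int) ^ card (prime_factors d) = (\<Prod>p\<in>prime_factors d. 2)"
    by simp
  also have "\<dots> \<le> (\<Prod>p\<in>prime_factors d. p)"
    by (intro prod_mono) (auto dest: in_prime_factors_imp_prime prime_ge_2_int)
  also have "\<dots> \<le> \<bar>d\<bar>"
  proof -
    have "(\<Prod>p\<in>prime_factors d. p) dvd (\<Prod>p\<in>prime_factors d. p ^ multiplicity p d)"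
      by (intro prod_dvd_prod dvd_power) (auto simp: prime_factors_multiplicity)
    also have "\<dots> = \<bar>d\<bar>"
      using prod_prime_factors[OF assms(1)] by simp
    finally show ?thesis
      using assms(1) by (intro zdvd_imp_le) auto
  qed
  also have "\<dots> \<le> 2 ^ L" by (rule assms(2))
  finally show "card {p. prime p \<and> p dvd d} \<le> L"
    unfolding eq by simp
qed

section \<open>Counting vectors in a span modulo a prime\<close>

text \<open>For prime \<open>p\<close> this is the span over the field with \<open>p\<close>
  elements, expressed by divisibility so that the same integer vectors can be tested against every
  prime.\<close>

definition in_span_mod :: "int \<Rightarrow> 'i set \<Rightarrow> ('i \<Rightarrow> 'j \<Rightarrow> int) \<Rightarrow> ('j \<Rightarrow> int) \<Rightarrow> bool" where
  "in_span_mod p S v u \<longleftrightarrow> (\<exists>c. \<forall>j. p dvd u j - (\<Sum>i\<in>S. c i * v i j))"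

text \<open>The sums run over a subset \<open>T\<close> of the coordinates so that forms omitting a
  coordinate are covered too.\<close>

lemma in_span_mod_annihilator:
  assumes "in_span_mod p S v u" and "\<And>i. i \<in> S \<Longrightarrow> p dvd (\<Sum>j\<in>T. f j * v i j)"
  shows "p dvd (\<Sum>j\<in>T. f j * u j)"
proof -
  obtain c where c: "\<And>j. p dvd u j - (\<Sum>i\<in>S. c i * v i j)"
    using assms(1) unfolding in_span_mod_def by blast
  have "(\<Sum>j\<in>T. f j * u j) =
      (\<Sum>j\<in>T. f j * (u j - (\<Sum>i\<in>S. c i * v i j))) + (\<Sum>j\<in>T. \<Sum>i\<in>S. c i * (f j * v i j))"
    by (simp add: right_diff_distrib sum_subtractf sum_distrib_left mult.left_commute)
  also have "(\<Sum>j\<in>T. \<Sum>i\<in>S. c i * (f j * v i j)) = (\<Sum>i\<in>S. c i * (\<Sum>j\<in>T. f j * v i j))"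
    unfolding sum_distrib_left by (rule sum.swap)
  finally show ?thesis
    using c assms(2) by (auto intro!: dvd_add dvd_sum intro: dvd_mult)
qed

section \<open>Affine forms on boxes\<close>

lemma affine_form_upd_diff:
  fixes f u w :: "'j \<Rightarrow> int"
  assumes "finite T" "j \<in> T"
  shows "(\<Sum>i\<in>T. f i * (u i + q * (w(j := s)) i)) - (\<Sum>i\<in>T. f i * (u i + q * (w(j := t)) i))
    = f j * q * (s - t)"
proof -
  have "(\<Sum>i\<in>T. f i * (u i + q * (w(j := s)) i)) - (\<Sum>i\<in>T. f i * (u i + q * (w(j := t)) i))
      = (\<Sum>i\<in>T. if i = j then f j * q * (s - t) else 0)"
    unfolding sum_subtractf[symmetric] by (intro sum.cong) (auto simp: algebra_simps)
  then show ?thesis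
    using assms by simp
qed

text \<open>Coordinates in \<open>J\<close> are frozen at 0 instead of being dropped, so that
  \<open>w(j := 0)\<close> maps one box into another of the same type.\<close>

definition int_box :: "nat \<Rightarrow> 'n set \<Rightarrow> ('n \<Rightarrow> int) set" where
  "int_box K J = (\<Pi>\<^sub>E i\<in>UNIV. if i \<in> J then {0} else {0..<int K})"

lemma finite_int_box: "finite (int_box K (J :: 'n::finite set))"
  unfolding int_box_def by (intro finite_PiE) auto

lemma card_int_box: "card (int_box K (J :: 'n::finite set)) = K ^ (CARD('n) - card J)"
proof -
  have "card (int_box K J) = (\<Prod>i\<in>UNIV. if i \<in> J then 1 else K)"
    unfolding int_box_def by (subst card_PiE) (auto intro!: prod.cong)
  also have "\<dots> = K ^ card (- J)"
    by (simp add: prod.If_cases)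
  finally show ?thesis
    by (simp add: card_Diff_subset Compl_eq_Diff_UNIV)
qed

lemma mem_int_box_iff: "w \<in> int_box K J \<longleftrightarrow> (\<forall>i. w i \<in> (if i \<in> J then {0} else {0..<int K}))"
  by (simp add: int_box_def PiE_iff)

lemma upd_in_int_box: "w(j := t) \<in> int_box K J \<Longrightarrow> j \<notin> J \<Longrightarrow> t \<in> {0..<int K}"
  unfolding mem_int_box_iff by (metis fun_upd_same)

lemma upd_zero_in_int_box: "w \<in> int_box K J \<Longrightarrow> w(j := 0) \<in> int_box K (insert j J)"
  unfolding mem_int_box_iff by (metis fun_upd_apply insert_iff singletonI)

lemma card_le_fibre_int_box:
  fixes A :: "('n::finite \<Rightarrow> int) set"
  assumes "A \<subseteq> int_box K J" and "j \<notin> J" and "\<And>w. w \<in> A \<Longrightarrow> card {t. w(j := t) \<in> A} \<le> N"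
  shows "card A \<le> N * K ^ (CARD('n) - Suc (card J))"
proof -
  have "card A \<le> N * card ((\<lambda>w. w(j := 0)) ` A)"
    using assms finite_subset[OF assms(1) finite_int_box] by (intro card_le_by_fibres)
  also have "card ((\<lambda>w. w(j := 0)) ` A) \<le> card (int_box K (insert j J))"
    using assms(1) by (intro card_mono finite_int_box) (auto intro: upd_zero_in_int_box)
  finally show ?thesis
    using assms(2) by (simp add: card_int_box)
qed

lemma prime_dvd_affine_upd:
  fixes f u w :: "'j \<Rightarrow> int" and p q :: int
  assumes "finite T" "j \<in> T" and p: "prime p" "\<not> p dvd q" "\<not> p dvd f j"
    and "p dvd (\<Sum>i\<in>T. f i * (u i + q * (w(j := s)) i))"
    and "p dvd (\<Sum>i\<in>T. f i * (u i + q * (w(j := t)) i))"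
  shows "p dvd s - t"
proof -
  have "p dvd f j * q * (s - t)"
    using dvd_diff[OF assms(6,7)] unfolding affine_form_upd_diff[OF assms(1,2)] .
  then show ?thesis
    using p by (simp add: prime_dvd_mult_iff)
qed

lemma card_fibre_affine_le:
  fixes A :: "('n::finite \<Rightarrow> int) set" and p q :: int
  assumes p: "prime p" "\<not> p dvd q" "\<not> p dvd f j" and T: "finite T" "j \<in> T"
    and A: "A \<subseteq> int_box K J" "j \<notin> J"
    and dvd: "\<And>w. w \<in> A \<Longrightarrow> p dvd (\<Sum>i\<in>T. f i * (u i + q * w i))"
  shows "card {t. w(j := t) \<in> A} \<le> nat (int K div p) + 1"
proof (rule card_congruent_le)
  show "p > 0"
    using p(1) by (rule prime_gt_0_int)
  show "{t. w(j := t) \<in> A} \<subseteq> {0..<int K}"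
  proof
    fix t assume "t \<in> {t. w(j := t) \<in> A}"
    then have "w(j := t) \<in> A" by simp
    from subsetD[OF A(1) this] show "t \<in> {0..<int K}"
      using A(2) by (rule upd_in_int_box)
  qed
  fix s t assume "s \<in> {t. w(j := t) \<in> A}" "t \<in> {t. w(j := t) \<in> A}"
  then have "w(j := s) \<in> A" "w(j := t) \<in> A" by simp_all
  from this[THEN dvd] show "p dvd s - t"
    by (rule prime_dvd_affine_upd[where f = f and j = j, OF T p])
qed

text \<open>The span has codimension at least 2 modulo \<open>p\<close>, so two independent forms
  vanish on it: \<open>f\<close> with \<open>f j\<close> prime to \<open>p\<close>, and
  \<open>g\<close> not involving \<open>j\<close>. The first fixes \<open>w j\<close> modulo
  \<open>p\<close> in terms of the other coordinates, the second fixes some \<open>w k\<close> with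
  \<open>k \<noteq> j\<close>.\<close>

lemma card_in_span_mod_le:
  fixes v :: "'i \<Rightarrow> 'n::finite \<Rightarrow> int" and u :: "'n \<Rightarrow> int" and p q :: int
  assumes S: "finite S" "card S + 2 \<le> CARD('n)" and p: "prime p" "\<not> p dvd q"
  shows "card {w \<in> int_box K {}. in_span_mod p S v (\<lambda>j. u j + q * w j)}
    \<le> K ^ (CARD('n) - 2) * (nat (int K div p) + 1)\<^sup>2"
proof -
  define N where "N = nat (int K div p) + 1"
  define A where "A = {w \<in> int_box K {}. in_span_mod p S v (\<lambda>j. u j + q * w j)}"
  have p2: "p \<ge> 2"
    using p(1) by (rule prime_ge_2_int)
  obtain f j where f: "\<And>i. i \<in> S \<Longrightarrow> p dvd (\<Sum>j\<in>UNIV. f j * v i j)" "\<not> p dvd f j"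
    using S p2 by (rule_tac annihilator_mod[where S = S and T = UNIV and v = v and p = p]) auto
  have "card S < card (UNIV - {j})"
    using S by simp
  then obtain g k where g: "\<And>i. i \<in> S \<Longrightarrow> p dvd (\<Sum>j\<in>UNIV - {j}. g j * v i j)" "\<not> p dvd g k" "k \<noteq> j"
    using S p2 by (rule_tac annihilator_mod[where S = S and T = "UNIV - {j}" and v = v and p = p]) auto
  define A' where "A' = {w \<in> int_box K {j}. p dvd (\<Sum>i\<in>UNIV - {j}. g i * (u i + q * w i))}"
  have A: "w \<in> int_box K {}" "in_span_mod p S v (\<lambda>j. u j + q * w j)" if "w \<in> A" for w
    using that unfolding A_def by simp_all
  \<comment> \<open>The condition given by \<open>g\<close> survives the projection because
    \<open>g\<close> omits \<open>j\<close>.\<close>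
  have "(\<lambda>w. w(j := 0)) ` A \<subseteq> A'"
  proof
    fix y assume "y \<in> (\<lambda>w. w(j := 0)) ` A"
    then obtain w where w: "y = w(j := 0)" "w \<in> A" by (rule imageE)
    have "p dvd (\<Sum>i\<in>UNIV - {j}. g i * (u i + q * w i))"
      using A(2)[OF w(2)] by (rule in_span_mod_annihilator) (rule g(1))
    moreover have "(\<Sum>i\<in>UNIV - {j}. g i * (u i + q * y i)) = (\<Sum>i\<in>UNIV - {j}. g i * (u i + q * w i))"
      unfolding w(1) by (intro sum.cong) auto
    ultimately show "y \<in> A'"
      unfolding A'_def using w(1) upd_zero_in_int_box[OF A(1)[OF w(2)]] by simp
  qed
  then have image: "card ((\<lambda>w. w(j := 0)) ` A) \<le> card A'"
    by (rule card_mono[rotated]) (simp add: A'_def finite_int_box)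
  have "card A \<le> N * card ((\<lambda>w. w(j := 0)) ` A)"
  proof (rule card_le_by_fibres)
    show "finite A"
      unfolding A_def by (simp add: finite_int_box)
    show "card {t. w(j := t) \<in> A} \<le> N" for w
      unfolding N_def
    proof (rule card_fibre_affine_le[where T = UNIV and f = f and J = "{}" and u = u, OF p f(2)])
      show "p dvd (\<Sum>i\<in>UNIV. f i * (u i + q * w i))" if "w \<in> A" for w
        using A(2)[OF that] by (rule in_span_mod_annihilator) (rule f(1))
    qed (use A(1) in auto)
  qed
  moreover have "card A' \<le> N * K ^ (CARD('n) - Suc (card {j}))"
  proof (rule card_le_fibre_int_box[where j = k])
    show sub: "A' \<subseteq> int_box K {j}"
      unfolding A'_def by blast
    show "card {t. w(k := t) \<in> A'} \<le> N" for w
      unfolding N_def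
      by (rule card_fibre_affine_le[where T = "UNIV - {j}" and f = g and u = u, OF p g(2) _ _ sub])
        (use g(3) in \<open>auto simp: A'_def\<close>)
  qed (use g(3) in simp)
  ultimately have "card A \<le> N * (N * K ^ (CARD('n) - 2))"
    using image by (metis card.empty card.insert empty_iff finite.emptyI le_trans mult_le_mono2 numeral_2_eq_2)
  then show ?thesis
    unfolding N_def A_def by (simp only: power2_eq_square ac_simps)
qed

section \<open>Union bound over the primes\<close>

lemma sum_inverse_squares_le:
  "(\<Sum>d = 2..K. 1 / (real d)\<^sup>2) \<le> 3 / 4"
proof (cases "K \<ge> 2")
  case True
  \<comment> \<open>The term \<open>1 / K\<close> makes the induction telescope. Comparing
    \<open>1 / d\<^sup>2\<close> with \<open>1 / ((d - 1) * d)\<close> only from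
    \<open>d = 3\<close> on gives 1/4 + 1/2 in place of 1.\<close>
  have "(\<Sum>d = 2..K. 1 / (real d)\<^sup>2) \<le> 3 / 4 - 1 / K"
    using True
  proof (induction K rule: dec_induct)
    case (step m)
    have "1 / (real (Suc m))\<^sup>2 \<le> 1 / (real m * real (Suc m))"
      using step by (intro divide_left_mono) (auto simp: power2_eq_square)
    also have "\<dots> = 1 / real m - 1 / real (Suc m)"
      using step by (simp add: field_simps)
    finally show ?case
      using step by simp
  qed simp
  then show ?thesis
    by (smt (verit) divide_nonneg_nonneg of_nat_0_le_iff)
qed simp

text \<open>The sum, taken over all \<open>d\<close> and not only primes, bounds the share of the
  box excluded by primes up to \<open>K\<close>. What matters is a leading coefficient below 1; the
  linear term is harmless for large \<open>K\<close>.\<close>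

lemma sum_fibre_bounds_le:
  "real (\<Sum>d = 2..K. (K div d + 1)\<^sup>2) \<le> 9 / 10 * (real K)\<^sup>2 + 6 * K"
proof -
  have "real ((K div d + 1)\<^sup>2) \<le> 6 / 5 * (real K)\<^sup>2 * (1 / (real d)\<^sup>2) + 6" for d
  proof -
    have "real ((K div d + 1)\<^sup>2) \<le> (real K / real d + 1)\<^sup>2"
      unfolding of_nat_power by (intro power_mono) (auto intro: of_nat_div_le_of_nat)
    \<comment> \<open>AM-GM, with weights making \<open>6/5 \<cdot> 3/4 < 1\<close>\<close>
    also have "\<dots> \<le> 6 / 5 * (real K / real d)\<^sup>2 + 6"
      using zero_le_power2[of "real K / real d / 5 - 1"] by (simp add: power2_eq_square algebra_simps)
    finally show ?thesis
      by (simp add: power_divide)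
  qed
  then have "real (\<Sum>d = 2..K. (K div d + 1)\<^sup>2) \<le> (\<Sum>d = 2..K. 6 / 5 * (real K)\<^sup>2 * (1 / (real d)\<^sup>2) + 6)"
    unfolding of_nat_sum by (intro sum_mono)
  also have "\<dots> = 6 / 5 * (real K)\<^sup>2 * (\<Sum>d = 2..K. 1 / (real d)\<^sup>2) + 6 * real (K + 1 - 2)"
    by (simp only: sum.distrib sum_distrib_left) simp
  also have "\<dots> \<le> 6 / 5 * (real K)\<^sup>2 * (3 / 4) + 6 * K"
    by (intro add_mono mult_left_mono sum_inverse_squares_le) auto
  finally show ?thesis by simp
qed

text \<open>Otherwise the box would be covered by the exceptional sets of all primes not dividing
  \<open>q\<close>. The primes up to \<open>K\<close> account for at most about 9/10 of it, the
  others for \<open>O(L / K)\<close>, where \<open>2 ^ L\<close> bounds the integers whose prime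
  divisors are counted.\<close>

lemma exists_row_not_in_span_mod:
  fixes v :: "'i \<Rightarrow> 'n::finite \<Rightarrow> int" and u :: "'n \<Rightarrow> int" and q :: int and B K L :: nat
  assumes S: "finite S" "card S + 2 \<le> CARD('n)" and q: "q \<noteq> 0" and B: "B \<ge> 1"
    and vB: "\<And>i j. i \<in> S \<Longrightarrow> \<bar>v i j\<bar> \<le> int B"
    and uB: "\<And>w j. w \<in> int_box K {} \<Longrightarrow> \<bar>u j + q * w j\<bar> \<le> int B"
    and L: "(3 * CARD('n) * B) ^ (CARD('n) + 1) \<le> 2 ^ L" and K: "90 * L < K"
  shows "\<exists>w\<in>int_box K {}. \<forall>p. prime p \<longrightarrow> \<not> p dvd q \<longrightarrow> \<not> in_span_mod p S v (\<lambda>j. u j + q * w j)"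
proof -
  define n where "n = CARD('n)"
  define Q where "Q = K ^ (n - 2)"
  have n2: "n \<ge> 2"
    using S(2) by (simp add: n_def)
  \<comment> \<open>These annihilators are taken over the integers because one pair
    \<open>F\<close>, \<open>G\<close> has to serve all primes above \<open>K\<close> at once. As in
    the count modulo one prime, \<open>G\<close> avoids a coordinate \<open>j\<close> on which
    \<open>F\<close> depends.\<close>
  obtain F j where F: "\<And>i. i \<in> S \<Longrightarrow> (\<Sum>j\<in>UNIV. F j * v i j) = 0" "F j \<noteq> 0"
      "\<And>j. \<bar>F j\<bar> \<le> (3 * int n * int B) ^ n"
  proof (rule small_annihilator[where S = S and T = UNIV and v = v and B = B])
    show "card S < CARD('n)" using S(2) by simp
  qed (use S(1) B vB in \<open>auto simp: n_def\<close>)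
  have cardT: "card (UNIV - {j}) = n - 1"
    by (simp add: n_def)
  obtain G k where G: "\<And>i. i \<in> S \<Longrightarrow> (\<Sum>j\<in>UNIV - {j}. G j * v i j) = 0" "G k \<noteq> 0" "k \<noteq> j"
      "\<And>i. i \<in> UNIV - {j} \<Longrightarrow> \<bar>G i\<bar> \<le> (3 * int (n - 1) * int B) ^ (n - 1)"
  proof (rule small_annihilator[where S = S and T = "UNIV - {j}" and v = v and B = B])
    show "card S < card (UNIV - {j})" unfolding cardT using S(2) by (simp add: n_def)
  qed (use S(1) B vB in \<open>auto simp: cardT\<close>)
  have nB: "int n * int B \<ge> 1"
    using n2 B mult_mono[of 1 "int n" 1 "int B"] by simp
  then have base: "3 * int n * int B \<ge> 1" by linarith
  have "(3 * int n * int B) ^ (n + 1) = int ((3 * CARD('n) * B) ^ (CARD('n) + 1))"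
    by (simp add: n_def)
  also have "\<dots> \<le> int (2 ^ L)"
    using L by (rule of_nat_mono)
  finally have L': "(3 * int n * int B) ^ (n + 1) \<le> 2 ^ L" by simp
  have "\<bar>F j\<bar> \<le> (3 * int n * int B) ^ (n + 1)"
    using F(3)[of j] power_increasing[OF _ base, of n "n + 1"] by linarith
  with L' have FL: "\<bar>F j\<bar> \<le> 2 ^ L" by linarith
  \<comment> \<open>A prime dividing \<open>D w\<close>, which does not involve \<open>w j\<close>, and the form given by \<open>F\<close> determines
    \<open>w j\<close> modulo itself unless it divides \<open>F j\<close>; for primes above \<open>K\<close> this leaves at most
    one value of \<open>w j\<close> per prime divisor of \<open>D w\<close>.\<close>
  define D where "D w = (\<Sum>i\<in>UNIV - {j}. G i * (u i + q * w i))" for w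
  have DL: "\<bar>D w\<bar> \<le> 2 ^ L" if "w \<in> int_box K {}" for w
  proof -
    have "\<bar>G i\<bar> \<le> (3 * int n * int B) ^ n" if "i \<in> UNIV - {j}" for i
    proof -
      have "(3 * int (n - 1) * int B) ^ (n - 1) \<le> (3 * int n * int B) ^ (n - 1)"
        by (intro power_mono mult_right_mono) auto
      also have "\<dots> \<le> (3 * int n * int B) ^ n"
        using base by (intro power_increasing) auto
      finally show ?thesis
        using G(4)[OF that] by linarith
    qed
    \<comment> \<open>The extra factor in the exponent \<open>n + 1\<close> pays for the number of
      terms and for the entries of size \<open>B\<close>.\<close>
    then have "\<bar>D w\<bar> \<le> int (card (UNIV - {j})) * ((3 * int n * int B) ^ n * int B)"
      unfolding D_def using uB[OF that] by (intro abs_sum_mult_le)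
    also have "\<dots> \<le> (3 * int n) * ((3 * int n * int B) ^ n * int B)"
      unfolding cardT by (intro mult_right_mono) auto
    also have "\<dots> = (3 * int n * int B) ^ (n + 1)"
      by (simp add: mult_ac)
    finally show ?thesis using L' by linarith
  qed
  \<comment> \<open>Four exceptional sets: \<open>P1\<close> collects the small primes,
    \<open>P2\<close> the large primes at which \<open>F\<close> loses its dependence on
    \<open>w j\<close>, \<open>E1\<close> the points where \<open>D w = 0\<close> restricts no
    prime, and \<open>E2\<close> the remaining points excluded by large primes.\<close>
  define A where "A p = {w \<in> int_box K {}. in_span_mod p S v (\<lambda>j. u j + q * w j)}" for p
  define P1 where "P1 = {p. prime p \<and> \<not> p dvd q \<and> p \<le> int K}"
  define P2 where "P2 = {p. prime p \<and> \<not> p dvd q \<and> p dvd F j \<and> int K < p}"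
  define E1 where "E1 = {w \<in> int_box K {}. D w = 0}"
  define E2 where "E2 = {w \<in> int_box K {}. D w \<noteq> 0 \<and> (\<exists>p. prime p \<and> \<not> p dvd q \<and> \<not> p dvd F j \<and>
    int K < p \<and> p dvd D w \<and> p dvd (\<Sum>i\<in>UNIV. F i * (u i + q * w i)))}"
  \<comment> \<open>Along direction \<open>k\<close> the form \<open>D\<close> is affine with slope
    \<open>G k * q \<noteq> 0\<close>, so it has at most one zero on each line.\<close>
  have "card E1 \<le> 1 * K ^ (CARD('n) - Suc (card ({} :: 'n set)))"
  proof (rule card_le_fibre_int_box)
    show "card {t. w(k := t) \<in> E1} \<le> 1" for w
    proof -
      have "s = t" if "w(k := s) \<in> E1" "w(k := t) \<in> E1" for s t
      proof -
        have "D (w(k := s)) - D (w(k := t)) = G k * q * (s - t)"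
          unfolding D_def using G(3) by (intro affine_form_upd_diff) auto
        then show ?thesis
          using that G(2) q by (simp add: E1_def)
      qed
      note unique = this
      show ?thesis
      proof (cases "{t. w(k := t) \<in> E1} = {}")
        case False
        then obtain s where s: "w(k := s) \<in> E1" by blast
        have "{t. w(k := t) \<in> E1} \<subseteq> {s}"
        proof
          fix t assume "t \<in> {t. w(k := t) \<in> E1}"
          then have "w(k := t) \<in> E1" by simp
          from unique[OF this s] show "t \<in> {s}" by simp
        qed
        from card_mono[OF _ this] show ?thesis by simp
      qed simp
    qed
  qed (auto simp: E1_def)
  moreover have "K ^ (CARD('n) - Suc (card ({} :: 'n set))) = K * Q"
  proof -
    have "CARD('n) - Suc (card ({} :: 'n set)) = Suc (n - 2)"
      using n2 by (simp add: n_def)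
    then show ?thesis
      by (simp add: Q_def)
  qed
  ultimately have E1: "card E1 \<le> K * Q" by simp
  have "card E2 \<le> L * K ^ (CARD('n) - Suc (card ({} :: 'n set)))"
  proof (rule card_le_fibre_int_box)
    fix w assume w: "w \<in> E2"
    \<comment> \<open>On a line in direction \<open>j\<close> all relevant primes divide the same
      non-zero integer \<open>D w\<close>, so at most \<open>L\<close> of them occur. It remains to
      map the points of the line injectively to such primes.\<close>
    have Dw: "D (w(j := t)) = D w" for t
      unfolding D_def by (intro sum.cong) auto
    let ?R = "\<lambda>p t. prime p \<and> \<not> p dvd q \<and> \<not> p dvd F j \<and> int K < p \<and> p dvd D w \<and>
      p dvd (\<Sum>i\<in>UNIV. F i * (u i + q * (w(j := t)) i))"
    define r where "r t = (SOME p. ?R p t)" for t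
    have r: "?R (r t) t" "t \<in> {0..<int K}" if "t \<in> {t. w(j := t) \<in> E2}" for t
    proof -
      have "w(j := t) \<in> E2" using that by simp
      then have *: "w(j := t) \<in> int_box K {} \<and> D w \<noteq> 0 \<and> (\<exists>p. ?R p t)"
        unfolding E2_def Dw mem_Collect_eq .
      note box = conjunct1[OF *]
      have "\<exists>p. ?R p t"
        using * by (elim conjE)
      then show "?R (r t) t"
        unfolding r_def by (rule someI_ex)
      show "t \<in> {0..<int K}"
        by (rule upd_in_int_box[OF box]) simp
    qed
    have "inj_on r {t. w(j := t) \<in> E2}"
    proof (rule inj_onI)
      fix s t assume st: "s \<in> {t. w(j := t) \<in> E2}" "t \<in> {t. w(j := t) \<in> E2}" "r s = r t"
      have "r s dvd s - t"
        using r(1)[OF st(1)] r(1)[OF st(2)] unfolding st(3)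
        by (intro prime_dvd_affine_upd[where f = F and T = UNIV and j = j and u = u and w = w and q = q])
          (simp_all del: fun_upd_apply)
      \<comment> \<open>Both points lie in \<open>{0..<int K}\<close> while the prime exceeds
        \<open>K\<close>, so congruence forces equality.\<close>
      moreover have "\<bar>s - t\<bar> < r s"
        using r(1)[OF st(1)] r(2)[OF st(1)] r(2)[OF st(2)] by auto
      ultimately show "s = t"
        using zdvd_imp_le[of "r s" "\<bar>s - t\<bar>"] by force
    qed
    moreover have "r ` {t. w(j := t) \<in> E2} \<subseteq> {p. prime p \<and> p dvd D w}"
    proof (rule image_subsetI)
      fix t assume "t \<in> {t. w(j := t) \<in> E2}"
      from r(1)[OF this] show "r t \<in> {p. prime p \<and> p dvd D w}" by simp
    qed
    moreover have "finite {p. prime p \<and> p dvd D w}" "card {p. prime p \<and> p dvd D w} \<le> L"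
      using card_prime_divisors_le[of "D w" L] DL w by (auto simp: E2_def)
    ultimately show "card {t. w(j := t) \<in> E2} \<le> L"
      by (meson card_inj_on_le order_trans)
  qed (auto simp: E2_def)
  then have E2: "card E2 \<le> L * (K * Q)"
    using \<open>K ^ (CARD('n) - Suc (card ({} :: 'n set))) = K * Q\<close> by simp
  have Ap: "card (A p) \<le> Q * (nat (int K div p) + 1)\<^sup>2" if "prime p" "\<not> p dvd q" for p
    unfolding A_def Q_def n_def using S that by (rule card_in_span_mod_le)
  have P1sub: "P1 \<subseteq> {2..int K}"
    unfolding P1_def using prime_ge_2_int by auto
  then have finP1: "finite P1"
    by (rule finite_subset) simp
  have "card (\<Union>p\<in>P1. A p) \<le> (\<Sum>p\<in>P1. card (A p))"
    by (rule card_UN_le[OF finP1])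
  also have "\<dots> \<le> (\<Sum>p\<in>P1. Q * (K div nat p + 1)\<^sup>2)"
  proof (rule sum_mono)
    fix p assume p: "p \<in> P1"
    then have "nat (int K div p) = K div nat p"
      using P1sub by (subst nat_div_distrib) auto
    then show "card (A p) \<le> Q * (K div nat p + 1)\<^sup>2"
      using Ap[of p] p by (simp add: P1_def)
  qed
  also have "\<dots> = (\<Sum>d\<in>nat ` P1. Q * (K div d + 1)\<^sup>2)"
  proof -
    have "inj_on nat P1"
      using P1sub by (intro inj_onI) (metis atLeastAtMost_iff eq_nat_nat_iff order_trans subsetD zero_le_numeral)
    then show ?thesis
      by (simp add: sum.reindex)
  qed
  also have "\<dots> \<le> (\<Sum>d = 2..K. Q * (K div d + 1)\<^sup>2)"
  proof (rule sum_mono2)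
    show "nat ` P1 \<subseteq> {2..K}"
    proof (rule image_subsetI)
      fix p assume "p \<in> P1"
      then have "p \<in> {2..int K}" by (rule subsetD[OF P1sub])
      then show "nat p \<in> {2..K}" by (simp add: le_nat_iff nat_le_iff)
    qed
  qed auto
  finally have U1: "card (\<Union>p\<in>P1. A p) \<le> Q * (\<Sum>d = 2..K. (K div d + 1)\<^sup>2)"
    by (simp add: sum_distrib_left)
  have P2sub: "P2 \<subseteq> {p. prime p \<and> p dvd F j}"
    unfolding P2_def by blast
  have finP2: "finite P2"
    using P2sub card_prime_divisors_le(1)[OF F(2) FL] by (rule finite_subset)
  have "card (\<Union>p\<in>P2. A p) \<le> (\<Sum>p\<in>P2. card (A p))"
    by (rule card_UN_le[OF finP2])
  also have "\<dots> \<le> (\<Sum>p\<in>P2. Q)"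
  proof (rule sum_mono)
    fix p assume p: "p \<in> P2"
    \<comment> \<open>A prime above \<open>K\<close> excludes at most one residue in each of two
      coordinates, hence at most \<open>Q\<close> points.\<close>
    then have "int K div p = 0"
      by (simp add: P2_def)
    then show "card (A p) \<le> Q"
      using Ap[of p] p by (simp add: P2_def)
  qed
  also have "\<dots> \<le> L * Q"
    using card_mono[OF card_prime_divisors_le(1)[OF F(2) FL] P2sub] card_prime_divisors_le(2)[OF F(2) FL]
    by simp
  finally have U2: "card (\<Union>p\<in>P2. A p) \<le> L * Q" .
  show ?thesis
  proof (rule ccontr)
    assume neg: "\<not> ?thesis"
    have "int_box K {} \<subseteq> E1 \<union> E2 \<union> (\<Union>p\<in>P1. A p) \<union> (\<Union>p\<in>P2. A p)"
    proof
      fix w :: "'n \<Rightarrow> int" assume w: "w \<in> int_box K {}"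
      with neg obtain p where p: "prime p" "\<not> p dvd q" and span: "in_span_mod p S v (\<lambda>j. u j + q * w j)"
        by blast
      have "p dvd D w"
        unfolding D_def using span by (rule in_span_mod_annihilator) (simp add: G(1))
      moreover have "p dvd (\<Sum>i\<in>UNIV. F i * (u i + q * w i))"
        using span by (rule in_span_mod_annihilator) (simp add: F(1))
      ultimately have "w \<in> E1 \<or> w \<in> E2" if "\<not> p dvd F j" "int K < p"
        using that p w unfolding E1_def E2_def by blast
      moreover have "w \<in> A p"
        using w span by (simp add: A_def)
      ultimately show "w \<in> E1 \<union> E2 \<union> (\<Union>p\<in>P1. A p) \<union> (\<Union>p\<in>P2. A p)"
        using p unfolding P1_def P2_def by (cases "p \<le> int K"; cases "p dvd F j") auto
    qed
    moreover have "finite (E1 \<union> E2 \<union> (\<Union>p\<in>P1. A p) \<union> (\<Union>p\<in>P2. A p))"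
      using finP1 finP2 by (simp add: E1_def E2_def A_def finite_int_box)
    ultimately have "card (int_box K ({} :: 'n set)) \<le> card (E1 \<union> E2 \<union> (\<Union>p\<in>P1. A p) \<union> (\<Union>p\<in>P2. A p))"
      by (intro card_mono)
    also have "\<dots> \<le> card E1 + card E2 + card (\<Union>p\<in>P1. A p) + card (\<Union>p\<in>P2. A p)"
      by (meson add_mono card_Un_le le_refl order_trans)
    also have "\<dots> \<le> Q * (K + L * K + (\<Sum>d = 2..K. (K div d + 1)\<^sup>2) + L)"
      using E1 E2 U1 U2 by (simp add: algebra_simps)
    also have "card (int_box K ({} :: 'n set)) = Q * K\<^sup>2"
    proof -
      have "card (int_box K ({} :: 'n set)) = K ^ n"
        by (simp add: card_int_box n_def)
      also have "\<dots> = K ^ (n - 2 + 2)"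
        using n2 by (simp only: le_add_diff_inverse2)
      finally show ?thesis
        by (simp only: power_add Q_def)
    qed
    finally have "Q * K\<^sup>2 \<le> Q * (K + L * K + (\<Sum>d = 2..K. (K div d + 1)\<^sup>2) + L)" .
    moreover have "Q > 0"
      using K by (simp add: Q_def)
    ultimately have "K\<^sup>2 \<le> K + L * K + (\<Sum>d = 2..K. (K div d + 1)\<^sup>2) + L"
      by simp
    then have "real (K\<^sup>2) \<le> real (K + L * K + (\<Sum>d = 2..K. (K div d + 1)\<^sup>2) + L)"
      by (rule of_nat_mono)
    then have le: "(real K)\<^sup>2 \<le> real K + real L * real K + (9 / 10 * (real K)\<^sup>2 + 6 * K) + real L"
      using sum_fibre_bounds_le[of K] by simp
    have L1: "L \<ge> 1"
    proof (rule ccontr)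
      assume "\<not> L \<ge> 1"
      then have "L = 0" by linarith
      then have "(3 * int n * int B) ^ (n + 1) \<le> 1"
        using L' by (simp only: power_0)
      moreover have "(3 * int n * int B) ^ 1 \<le> (3 * int n * int B) ^ (n + 1)"
        using base by (intro power_increasing) auto
      ultimately show False
        using nB by simp
    qed
    have "real K \<le> real L * real K" "real L \<le> real L * real K"
      using L1 K mult_right_mono[of 1 "real L" "real K"] mult_left_mono[of 1 "real K" "real L"] by auto
    \<comment> \<open>The lower terms \<open>K + L * K + 6 * K + L\<close> are at most
      \<open>9 * L * K\<close>, against the remaining tenth of \<open>K\<^sup>2\<close>; this is the
      origin of 90.\<close>
    with le have "(real K)\<^sup>2 \<le> 90 * real L * real K" by simp
    moreover have "90 * real L * real K < real K * real K"
      using K by (intro mult_strict_right_mono) linarith+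
    ultimately show False
      by (simp add: power2_eq_square)
  qed
qed

section \<open>Independence modulo primes and cofactors\<close>

definition indep_mod :: "int \<Rightarrow> 'i set \<Rightarrow> ('i \<Rightarrow> 'j \<Rightarrow> int) \<Rightarrow> bool" where
  "indep_mod p S v \<longleftrightarrow> (\<forall>c. (\<forall>j. p dvd (\<Sum>i\<in>S. c i * v i j)) \<longrightarrow> (\<forall>i\<in>S. p dvd c i))"

lemma indep_mod_cong:
  assumes "indep_mod p S v" and "\<And>i j. i \<in> S \<Longrightarrow> p dvd v' i j - v i j"
  shows "indep_mod p S v'"
  unfolding indep_mod_def
proof (intro allI impI)
  fix c assume c: "\<forall>j. p dvd (\<Sum>i\<in>S. c i * v' i j)"
  have "p dvd (\<Sum>i\<in>S. c i * v i j)" for j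
  proof -
    have "(\<Sum>i\<in>S. c i * v i j) = (\<Sum>i\<in>S. c i * v' i j) - (\<Sum>i\<in>S. c i * (v' i j - v i j))"
      by (simp add: right_diff_distrib sum_subtractf)
    moreover have "p dvd (\<Sum>i\<in>S. c i * (v' i j - v i j))"
      using assms(2) by (intro dvd_sum dvd_mult) auto
    ultimately show ?thesis
      using c by simp
  qed
  then show "\<forall>i\<in>S. p dvd c i"
    using assms(1) unfolding indep_mod_def by blast
qed

lemma indep_mod_insert:
  fixes p :: int
  assumes p: "prime p" and S: "finite S" "s \<notin> S"
    and indep: "indep_mod p S v" and nspan: "\<not> in_span_mod p S v (v s)"
  shows "indep_mod p (insert s S) v"
  unfolding indep_mod_def
proof (intro allI impI)
  fix c assume "\<forall>j. p dvd (\<Sum>i\<in>insert s S. c i * v i j)"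
  then have c: "p dvd c s * v s j + (\<Sum>i\<in>S. c i * v i j)" for j
    using S by simp
  have cs: "p dvd c s"
  proof (rule ccontr)
    assume "\<not> p dvd c s"
    then have "coprime (c s) p"
      using p prime_imp_coprime coprime_commute by blast
    then obtain d where "[c s * d = 1] (mod p)"
      by (metis cong_solve_coprime_int)
    then have d: "p dvd c s * d - 1"
      by (simp add: cong_iff_dvd_diff)
    have "p dvd v s j - (\<Sum>i\<in>S. (- d * c i) * v i j)" for j
    proof -
      have "v s j - (\<Sum>i\<in>S. (- d * c i) * v i j)
          = d * (c s * v s j + (\<Sum>i\<in>S. c i * v i j)) - (c s * d - 1) * v s j"
        by (simp add: sum_distrib_left sum_negf algebra_simps)
      then show ?thesis
        using c[of j] d by simp
    qed
    then have "in_span_mod p S v (v s)"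
      unfolding in_span_mod_def by (intro exI[of _ "\<lambda>i. - d * c i"] allI)
    with nspan show False ..
  qed
  then have "p dvd (\<Sum>i\<in>S. c i * v i j)" for j
    using c[of j] by (simp add: dvd_add_right_iff)
  then have "\<forall>i\<in>S. p dvd c i"
    using indep unfolding indep_mod_def by blast
  with cs show "\<forall>i\<in>insert s S. p dvd c i" by simp
qed

text \<open>Putting the combination in place of row \<open>i\<close> turns the determinant into
  \<open>c i * det A\<close>, and this is divisible by \<open>p\<close> because the new row
  is.\<close>

lemma indep_mod_det:
  fixes A :: "int ^ 'n ^ 'n::finite"
  assumes p: "prime p" and det: "\<not> p dvd det A"
  shows "indep_mod p S (\<lambda>i j. A $ i $ j)"
  unfolding indep_mod_def
proof (intro allI impI ballI)
  fix c i assume c: "\<forall>j. p dvd (\<Sum>i\<in>S. c i * A $ i $ j)" and i: "i \<in> S"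
  define z where "z = (\<chi> j. (\<Sum>k\<in>S. c k * A $ k $ j) div p)"
  have "(\<Sum>k\<in>S. c k *s A $ k) = p *s z"
    using c by (simp add: vec_eq_iff z_def)
  then have "det (\<chi> r. if r = i then (\<Sum>k\<in>S. c k *s A $ k) else A $ r)
      = p * det (\<chi> r. if r = i then z else A $ r)"
    by (simp only: det_row_mul)
  then have "p dvd det (\<chi> r. if r = i then (\<Sum>k\<in>S. c k *s A $ k) else A $ r)"
    by simp
  also have "det (\<chi> r. if r = i then (\<Sum>k\<in>S. c k *s A $ k) else A $ r)
      = (\<Sum>k\<in>S. det (\<chi> r. if r = i then c k *s A $ k else A $ r))"
    by (rule det_linear_row_sum) simp
  also have "\<dots> = (\<Sum>k\<in>S. if k = i then c i * det A else 0)"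
  proof (rule sum.cong)
    fix k assume "k \<in> S"
    have "det (\<chi> r. if r = i then c k *s A $ k else A $ r) = c k * det (\<chi> r. if r = i then A $ k else A $ r)"
      by (rule det_row_mul)
    also have "\<dots> = (if k = i then c i * det A else 0)"
    proof (cases "k = i")
      case True
      have "(\<chi> r. if r = i then A $ i else A $ r) = A"
        by (simp add: vec_eq_iff)
      with True show ?thesis by (simp only: if_True refl)
    next
      case False
      then have "det (\<chi> r. if r = i then A $ k else A $ r) = 0"
        by (intro det_identical_rows[of i k]) (simp_all add: row_def vec_eq_iff)
      with False show ?thesis by simp
    qed
    finally show "det (\<chi> r. if r = i then c k *s A $ k else A $ r) = (if k = i then c i * det A else 0)" .
  qed simp
  also have "\<dots> = c i * det A"
    using i by simp
  finally show "p dvd c i"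
    using p det by (simp add: prime_dvd_mult_iff)
qed

lemma det_cong_mod:
  fixes A B :: "int ^ 'n ^ 'n::finite"
  assumes "q \<ge> 2" and "reduce_mod q A = reduce_mod q B"
  shows "det A mod q = det B mod q"
  using det_over_residue_ring[OF assms(1), of A] det_over_residue_ring[OF assms(1), of B] assms(2)
  by simp

text \<open>Independence makes the map from coefficients to row combinations injective on residue
  vectors, hence surjective by finiteness. Preimages of the unit vectors form a left inverse
  \<open>W\<close> of \<open>A\<close> modulo \<open>p\<close>.\<close>

lemma not_dvd_det_of_indep_mod:
  fixes A :: "int ^ 'n ^ 'n::finite"
  assumes p: "prime p" and indep: "indep_mod p UNIV (\<lambda>i j. A $ i $ j)"
  shows "\<not> p dvd det A"
proof
  assume dvd: "p dvd det A"
  have p2: "p \<ge> 2"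
    using p by (rule prime_ge_2_int)
  let ?X = "UNIV \<rightarrow>\<^sub>E {0..<p} :: ('n \<Rightarrow> int) set"
  let ?f = "\<lambda>g :: 'n \<Rightarrow> int. \<lambda>j. (\<Sum>i\<in>UNIV. g i * A $ i $ j) mod p"
  have "inj_on ?f ?X"
  proof (rule inj_onI)
    fix g h assume gh: "g \<in> ?X" "h \<in> ?X" "?f g = ?f h"
    have "p dvd (\<Sum>i\<in>UNIV. (g i - h i) * A $ i $ j)" for j
      using fun_cong[OF gh(3), of j] by (simp add: mod_eq_dvd_iff left_diff_distrib sum_subtractf)
    then have "\<forall>i\<in>UNIV. p dvd g i - h i"
      using spec[OF indep[unfolded indep_mod_def], of "\<lambda>i. g i - h i"] by simp
    then have "p dvd g i - h i" for i by blast
    then have "g i mod p = h i mod p" for i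
      by (simp add: mod_eq_dvd_iff)
    moreover have "g i \<in> {0..<p}" "h i \<in> {0..<p}" for i
      using gh(1,2) by (auto dest: PiE_mem)
    ultimately show "g = h"
      by (intro ext) (metis atLeastLessThan_iff mod_pos_pos_trivial)
  qed
  moreover have "?f ` ?X \<subseteq> ?X"
    using p2 by auto
  ultimately have surj: "?f ` ?X = ?X"
    by (intro endo_inj_surj finite_PiE) auto
  have "\<exists>g. ?f g = (\<lambda>j. if j = k then 1 else 0)" for k
  proof -
    have "(\<lambda>j. if j = k then 1 else 0) \<in> ?X"
      using p2 by (simp add: PiE_iff)
    then have "(\<lambda>j. if j = k then 1 else 0) \<in> ?f ` ?X"
      by (simp only: surj)
    then show ?thesis
      by (elim imageE) (rule exI, erule sym)
  qed
  then obtain g where g: "?f (g k) = (\<lambda>j. if j = k then 1 else 0)" for k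
    by metis
  define W where "W = (\<chi> k i. g k i)"
  have "reduce_mod p (W ** A) = reduce_mod p (mat 1)"
    using fun_cong[OF g] p2
    by (simp add: reduce_mod_def map_matrix_def vec_eq_iff matrix_matrix_mult_def W_def mat_def)
  then have "det (W ** A) mod p = 1"
    using det_cong_mod[OF p2, of "W ** A" "mat 1"] p2 by simp
  moreover have "p dvd det (W ** A)"
    using dvd by (simp add: det_mul)
  ultimately show False
    by auto
qed

section \<open>Cofactors of one row\<close>

definition replace_row :: "'n \<Rightarrow> 'a ^ 'n \<Rightarrow> 'a ^ 'n ^ 'n \<Rightarrow> 'a ^ 'n ^ 'n::finite" where
  "replace_row r a A = (\<chi> i. if i = r then a else A $ i)"

text \<open>Row \<open>r\<close> of the cofactor matrix. Each cofactor is a determinant of full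
  size, so no minors are formed, and the vector does not depend on row \<open>r\<close> of
  \<open>A\<close>.\<close>

definition cofactor_vec :: "'n \<Rightarrow> 'a::comm_ring_1 ^ 'n ^ 'n \<Rightarrow> 'a ^ 'n::finite" where
  "cofactor_vec r A = (\<chi> j. det (replace_row r (axis j 1) A))"

text \<open>Laplace expansion along row \<open>r\<close>, from linearity in that row.\<close>

lemma det_replace_row:
  fixes A :: "'a::comm_ring_1 ^ 'n ^ 'n::finite"
  shows "det (replace_row r a A) = (\<Sum>j\<in>UNIV. a $ j * cofactor_vec r A $ j)"
proof -
  have "a = (\<Sum>j\<in>UNIV. a $ j *s axis j 1)"
    by (simp add: basis_expansion)
  then have "det (replace_row r a A) = det (\<chi> i. if i = r then \<Sum>j\<in>UNIV. a $ j *s axis j 1 else A $ i)"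
    unfolding replace_row_def by (rule arg_cong)
  also have "\<dots> = (\<Sum>j\<in>UNIV. det (\<chi> i. if i = r then a $ j *s axis j 1 else A $ i))"
    by (rule det_linear_row_sum) simp
  finally show ?thesis
    by (simp add: det_row_mul cofactor_vec_def replace_row_def)
qed

text \<open>The combinations of fewer than \<open>CARD('n)\<close> vectors give too few residue
  vectors to exhaust the space.\<close>

lemma exists_not_in_span_mod:
  fixes v :: "'n \<Rightarrow> 'n::finite \<Rightarrow> int"
  assumes "p \<ge> 2" and T: "T \<noteq> UNIV"
  shows "\<exists>u. \<not> in_span_mod p T v u"
proof -
  let ?f = "\<lambda>g :: 'n \<Rightarrow> int. \<lambda>j. (\<Sum>i\<in>T. g i * v i j) mod p"
  let ?X = "UNIV \<rightarrow>\<^sub>E {0..<p} :: ('n \<Rightarrow> int) set"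
  have "card (?f ` (T \<rightarrow>\<^sub>E {0..<p})) \<le> card (T \<rightarrow>\<^sub>E {0..<p})"
    by (intro card_image_le finite_PiE) auto
  also have "\<dots> = nat p ^ card T"
    by (simp add: card_PiE)
  also have "\<dots> < nat p ^ CARD('n)"
    using assms by (intro power_strict_increasing psubset_card_mono) auto
  also have "\<dots> = card ?X"
    by (simp add: card_PiE)
  finally have "\<not> ?X \<subseteq> ?f ` (T \<rightarrow>\<^sub>E {0..<p})"
    using card_mono[of "?f ` (T \<rightarrow>\<^sub>E {0..<p})" ?X] by (auto simp: finite_PiE)
  then obtain u where u: "u \<in> ?X" "u \<notin> ?f ` (T \<rightarrow>\<^sub>E {0..<p})"
    by blast
  have "\<not> in_span_mod p T v u"
  proof
    assume "in_span_mod p T v u"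
    then obtain c where c: "\<And>j. p dvd u j - (\<Sum>i\<in>T. c i * v i j)"
      unfolding in_span_mod_def by blast
    let ?c = "\<lambda>i\<in>T. c i mod p"
    have "?f ?c j = u j" for j
    proof -
      have "?f ?c j = (\<Sum>i\<in>T. (c i mod p) * v i j) mod p"
        by simp
      also have "\<dots> = (\<Sum>i\<in>T. (c i mod p) * v i j mod p) mod p"
        by (rule mod_sum_eq[symmetric])
      also have "\<dots> = (\<Sum>i\<in>T. c i * v i j mod p) mod p"
        by (simp add: mod_mult_left_eq)
      also have "\<dots> = (\<Sum>i\<in>T. c i * v i j) mod p"
        by (rule mod_sum_eq)
      also have "\<dots> = u j mod p"
        using c[of j] by (simp add: mod_eq_dvd_iff dvd_diff_commute)
      also have "\<dots> = u j"
      proof -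
        have "u j \<in> {0..<p}" using PiE_mem[OF u(1)] by simp
        then show ?thesis by simp
      qed
      finally show ?thesis .
    qed
    then have "u = ?f ?c" by (intro ext) (rule sym)
    moreover have "?c \<in> T \<rightarrow>\<^sub>E {0..<p}"
      using assms(1) by auto
    ultimately have "u \<in> ?f ` (T \<rightarrow>\<^sub>E {0..<p})"
      by (rule image_eqI)
    with u(2) show False ..
  qed
  then show ?thesis by blast
qed

text \<open>A vector outside the span of the other rows completes them to an independent family. Its
  determinant is prime to \<open>p\<close>, yet it is a combination of the cofactors.\<close>

lemma not_dvd_cofactor_vec:
  fixes A :: "int ^ 'n ^ 'n::finite"
  assumes p: "prime p" and indep: "indep_mod p (UNIV - {r}) (\<lambda>i j. A $ i $ j)"
  shows "\<exists>j. \<not> p dvd cofactor_vec r A $ j"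
proof -
  obtain u where u: "\<not> in_span_mod p (UNIV - {r}) (\<lambda>i j. A $ i $ j) u"
    using exists_not_in_span_mod[OF prime_ge_2_int[OF p], of "UNIV - {r}"] by blast
  let ?M = "replace_row r (\<chi> j. u j) A"
  have "in_span_mod p (UNIV - {r}) (\<lambda>i j. ?M $ i $ j) u = in_span_mod p (UNIV - {r}) (\<lambda>i j. A $ i $ j) u"
    by (simp add: in_span_mod_def replace_row_def)
  moreover have "(\<lambda>j. ?M $ r $ j) = u"
    by (simp add: replace_row_def)
  ultimately have "indep_mod p (insert r (UNIV - {r})) (\<lambda>i j. ?M $ i $ j)"
    using u by (intro indep_mod_insert p indep_mod_cong[OF indep]) (auto simp: replace_row_def)
  then have "\<not> p dvd det ?M"
    by (intro not_dvd_det_of_indep_mod p) (simp add: insert_UNIV)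
  then show ?thesis
    unfolding det_replace_row by (meson dvd_mult dvd_sum)
qed

section \<open>Bezout relations for coprime families\<close>

lemma bezout_Gcd:
  fixes c :: "'j \<Rightarrow> int"
  assumes "finite T"
  shows "\<exists>b. (\<Sum>j\<in>T. b j * c j) = Gcd (c ` T)"
  using assms
proof (induction T rule: finite_induct)
  case (insert k T)
  then obtain b where b: "(\<Sum>j\<in>T. b j * c j) = Gcd (c ` T)" by blast
  obtain x y where xy: "x * c k + y * Gcd (c ` T) = gcd (c k) (Gcd (c ` T))"
    using bezout_int by blast
  have "(\<Sum>j\<in>insert k T. (if j = k then x else y * b j) * c j) = x * c k + (\<Sum>j\<in>T. y * b j * c j)"
    using insert.hyps by (auto intro!: sum.cong)
  also have "(\<Sum>j\<in>T. y * b j * c j) = y * Gcd (c ` T)"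
    unfolding b[symmetric] by (simp add: sum_distrib_left mult.assoc)
  finally show ?case
    using xy by (intro exI[of _ "\<lambda>j. if j = k then x else y * b j"]) simp
qed simp

lemma bezout_family:
  fixes c :: "'j \<Rightarrow> int"
  assumes "finite T" and "\<And>p. prime p \<Longrightarrow> \<exists>j\<in>T. \<not> p dvd c j"
  shows "\<exists>b. (\<Sum>j\<in>T. b j * c j) = 1"
proof -
  have "is_unit (Gcd (c ` T))"
  proof (rule ccontr)
    assume "\<not> is_unit (Gcd (c ` T))"
    then obtain p where p: "prime p" "p dvd Gcd (c ` T)"
    proof (cases "Gcd (c ` T) = 0")
      case True
      show ?thesis
      proof (rule that[of 2])
        show "2 dvd Gcd (c ` T)" unfolding True by simp
      qed simp
    qed (use prime_divisor_exists in blast)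
    then have "p dvd c j" if "j \<in> T" for j
      using that by (meson Gcd_dvd dvd_trans imageI)
    with assms(2)[OF p(1)] show False by blast
  qed
  then have "Gcd (c ` T) = 1"
    by (metis is_unit_normalize normalize_Gcd)
  then show ?thesis
    using bezout_Gcd[OF assms(1), of c] by simp
qed

section \<open>Lifting matrices\<close>

text \<open>Rows are added one at a time. Primes not dividing \<open>q\<close> are handled by the
  choice of the new row; primes dividing \<open>q\<close> need no choice, since modulo them the rows
  are those of \<open>x\<close>.\<close>

lemma lift_rows:
  fixes x :: "int ^ 'n ^ 'n::finite" and q :: int and B K L :: nat
  assumes q: "q \<ge> 2" and x: "\<And>i j. x $ i $ j \<in> {0..<q}" and det: "det x mod q = 1"
    and B: "q * (int K + 1) \<le> int B"
    and L: "(3 * CARD('n) * B) ^ (CARD('n) + 1) \<le> 2 ^ L" and K: "90 * L < K"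
    and S: "S \<noteq> UNIV"
  shows "\<exists>w. (\<forall>i\<in>S. w i \<in> int_box K {}) \<and>
    (\<forall>p. prime p \<longrightarrow> indep_mod p S (\<lambda>i j. x $ i $ j + q * w i j))"
proof -
  have bound: "\<bar>x $ i $ j + q * w j\<bar> \<le> int B" if "w \<in> int_box K {}" for i j and w :: "'n \<Rightarrow> int"
  proof -
    have w: "0 \<le> w j" "w j < int K"
      using that unfolding mem_int_box_iff by (simp_all add: Ball_def)
    then have "0 \<le> q * w j" "q * w j \<le> q * int K"
      using q by simp_all
    moreover have "0 \<le> x $ i $ j" "x $ i $ j < q"
      using x[of i j] by simp_all
    ultimately show ?thesis
      using B unfolding distrib_left by linarith
  qed
  have B1: "B \<ge> 1"
  proof -
    have "1 * 1 \<le> q * (int K + 1)"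
      using q by (intro mult_mono) auto
    with B show ?thesis by linarith
  qed
  have "finite S" by simp
  then show ?thesis
    using S
  proof (induction S rule: finite_induct)
    case empty
    then show ?case by (simp add: indep_mod_def)
  next
    case (insert s S)
    then have "S \<noteq> UNIV" by blast
    with insert.IH obtain w where w: "\<And>i. i \<in> S \<Longrightarrow> w i \<in> int_box K {}"
      "\<And>p. prime p \<Longrightarrow> indep_mod p S (\<lambda>i j. x $ i $ j + q * w i j)"
      by blast
    \<comment> \<open>The set stays proper after the insertion, so at most
      \<open>CARD('n) - 2\<close> rows precede the new one.\<close>
    have "card (insert s S) < CARD('n)"
      using insert.prems by (intro psubset_card_mono) auto
    then have card: "card S + 2 \<le> CARD('n)"
      using insert.hyps by simp
    have "\<exists>y\<in>int_box K {}. \<forall>p. prime p \<longrightarrow> \<not> p dvd q \<longrightarrow>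
        \<not> in_span_mod p S (\<lambda>i j. x $ i $ j + q * w i j) (\<lambda>j. x $ s $ j + q * y j)"
      using q w(1) bound by (intro exists_row_not_in_span_mod[OF insert.hyps(1) card _ B1 _ _ L K]) auto
    then obtain y where y: "y \<in> int_box K {}" "\<And>p. prime p \<Longrightarrow> \<not> p dvd q \<Longrightarrow>
        \<not> in_span_mod p S (\<lambda>i j. x $ i $ j + q * w i j) (\<lambda>j. x $ s $ j + q * y j)"
      by blast
    define w' where "w' = w(s := y)"
    have w'S: "w' i = w i" if "i \<in> S" for i
      using that insert.hyps by (auto simp: w'_def)
    have w's: "w' s = y"
      by (simp add: w'_def)
    have "indep_mod p (insert s S) (\<lambda>i j. x $ i $ j + q * w' i j)" if p: "prime p" for p
    proof (cases "p dvd q")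
      case True
      have "\<not> p dvd det x"
      proof
        assume "p dvd det x"
        then have "p dvd det x mod q"
          using True by (simp add: dvd_mod_iff)
        then show False
          using p unfolding det by (metis not_prime_unit)
      qed
      then have "indep_mod p (insert s S) (\<lambda>i j. x $ i $ j)"
        by (rule indep_mod_det[OF p])
      then show ?thesis
        using True by (rule_tac indep_mod_cong) auto
    next
      case False
      have "in_span_mod p S (\<lambda>i j. x $ i $ j + q * w' i j) u = in_span_mod p S (\<lambda>i j. x $ i $ j + q * w i j) u" for u
        by (simp add: in_span_mod_def w'S)
      then show ?thesis
        using y(2)[OF p False] w's insert.hyps
        by (intro indep_mod_insert p indep_mod_cong[OF w(2)[OF p]]) (auto simp: w'S)
    qed
    moreover have "\<forall>i\<in>insert s S. w' i \<in> int_box K {}"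
      using w(1) w'S w's y(1) by simp
    ultimately show ?case by blast
  qed
qed

section \<open>Shortening the last row\<close>

lemma det_of_int:
  fixes A :: "int ^ 'n ^ 'n::finite"
  shows "det (map_matrix real_of_int A) = real_of_int (det A)"
  by (simp add: det_def map_matrix_def)

text \<open>The sum is the determinant of \<open>A\<close> with row \<open>i\<close> copied into row
  \<open>r\<close>, which has two equal rows.\<close>

lemma cofactor_vec_orthogonal:
  fixes A :: "'a::comm_ring_1 ^ 'n ^ 'n::finite"
  assumes "i \<noteq> r"
  shows "(\<Sum>j\<in>UNIV. A $ i $ j * cofactor_vec r A $ j) = 0"
  unfolding det_replace_row[symmetric] using assms
  by (intro det_identical_rows[of i r]) (simp_all add: row_def replace_row_def vec_eq_iff)

text \<open>Subtracting integer multiples of the other rows preserves the inner product with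
  \<open>c\<close>. In real coordinates along these rows and \<open>c\<close>, the row coordinates
  become fractional parts, and the coordinate along \<open>c\<close> is determined by the inner
  product.\<close>

lemma reduce_vec_mod_rows:
  fixes A :: "int ^ 'n ^ 'n::finite" and b :: "int ^ 'n" and r :: 'n
  defines "c \<equiv> cofactor_vec r A"
  assumes c: "c \<noteq> 0"
  obtains b' :: "int ^ 'n" where "(\<Sum>j\<in>UNIV. b' $ j * c $ j) = (\<Sum>j\<in>UNIV. b $ j * c $ j)"
    "\<And>j. real_of_int \<bar>b' $ j\<bar> \<le> (\<Sum>i\<in>UNIV - {r}. real_of_int \<bar>A $ i $ j\<bar>) +
      real_of_int \<bar>\<Sum>j\<in>UNIV. b $ j * c $ j\<bar> / norm (\<chi> j. real_of_int (c $ j))"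
proof -
  define cr :: "real ^ 'n" where "cr = (\<chi> j. real_of_int (c $ j))"
  define M where "M = map_matrix real_of_int (replace_row r c A)"
  define s where "s = real_of_int (\<Sum>j\<in>UNIV. b $ j * c $ j)"
  have norm: "(norm cr)\<^sup>2 = (\<Sum>j\<in>UNIV. real_of_int (c $ j) * real_of_int (c $ j))"
    by (simp add: cr_def norm_vec_def L2_set_def sum_nonneg power2_eq_square)
  have cr0: "norm cr > 0"
    using c by (auto simp: cr_def vec_eq_iff)
  \<comment> \<open>Hence the other rows of \<open>A\<close> together with \<open>c\<close> form a
    basis of real space, and \<open>t\<close> below holds the coordinates of \<open>b\<close> in
    it.\<close>
  have "det M = (norm cr)\<^sup>2"
    unfolding M_def det_of_int det_replace_row norm c_def by simp
  then have "invertible M"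
    using cr0 by (simp add: invertible_det_nz)
  then obtain N where N: "N ** M = mat 1"
    unfolding invertible_def by blast
  define t where "t = (\<chi> j. real_of_int (b $ j)) v* N"
  have "t v* M = (\<chi> j. real_of_int (b $ j))"
    unfolding t_def by (simp add: vector_matrix_mul_assoc N)
  then have b: "real_of_int (b $ j) = (\<Sum>i\<in>UNIV. t $ i * M $ i $ j)" for j
    by (simp add: vector_matrix_mult_def vec_eq_iff mult.commute)
  have Mi: "M $ i $ j = real_of_int (A $ i $ j)" if "i \<noteq> r" for i j
    using that by (simp add: M_def map_matrix_def replace_row_def)
  have Mr: "M $ r $ j = cr $ j" for j
    by (simp add: M_def map_matrix_def replace_row_def cr_def)
  have b_split: "real_of_int (b $ j) = t $ r * cr $ j + (\<Sum>i\<in>UNIV - {r}. t $ i * real_of_int (A $ i $ j))" for j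
    unfolding b by (subst sum.remove[of _ r]) (auto simp: Mi Mr)
  have orth: "(\<Sum>j\<in>UNIV. real_of_int (A $ i $ j) * cr $ j) = 0" if "i \<noteq> r" for i
  proof -
    have "(\<Sum>j\<in>UNIV. real_of_int (A $ i $ j) * cr $ j) = real_of_int (\<Sum>j\<in>UNIV. A $ i $ j * c $ j)"
      by (simp add: cr_def)
    then show ?thesis
      using cofactor_vec_orthogonal[OF that, of A] by (simp add: c_def)
  qed
  \<comment> \<open>Pairing with \<open>c\<close> kills the other rows and isolates
    \<open>t $ r\<close>.\<close>
  have "s = (\<Sum>j\<in>UNIV. real_of_int (b $ j) * cr $ j)"
    by (simp add: s_def cr_def)
  also have "\<dots> = (\<Sum>j\<in>UNIV. t $ r * (cr $ j * cr $ j) +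
      (\<Sum>i\<in>UNIV - {r}. t $ i * (real_of_int (A $ i $ j) * cr $ j)))"
    unfolding b_split by (simp add: distrib_right sum_distrib_right mult.assoc)
  also have "\<dots> = t $ r * (\<Sum>j\<in>UNIV. cr $ j * cr $ j) +
      (\<Sum>j\<in>UNIV. \<Sum>i\<in>UNIV - {r}. t $ i * (real_of_int (A $ i $ j) * cr $ j))"
    by (simp add: sum.distrib sum_distrib_left)
  also have "(\<Sum>j\<in>UNIV. \<Sum>i\<in>UNIV - {r}. t $ i * (real_of_int (A $ i $ j) * cr $ j))
      = (\<Sum>i\<in>UNIV - {r}. t $ i * (\<Sum>j\<in>UNIV. real_of_int (A $ i $ j) * cr $ j))"
    unfolding sum_distrib_left by (rule sum.swap)
  also have "\<dots> = 0"
    by (intro sum.neutral ballI) (simp add: orth)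
  also have "(\<Sum>j\<in>UNIV. cr $ j * cr $ j) = (norm cr)\<^sup>2"
    unfolding norm by (simp add: cr_def)
  finally have "s = t $ r * (norm cr)\<^sup>2" by simp
  then have tr: "t $ r = s / (norm cr)\<^sup>2"
    using cr0 by (simp add: field_simps)
  define b' where "b' = (\<chi> j. b $ j - (\<Sum>i\<in>UNIV - {r}. \<lfloor>t $ i\<rfloor> * A $ i $ j))"
  show thesis
  proof (rule that)
    have "(\<Sum>j\<in>UNIV. \<Sum>i\<in>UNIV - {r}. \<lfloor>t $ i\<rfloor> * (A $ i $ j * c $ j))
        = (\<Sum>i\<in>UNIV - {r}. \<lfloor>t $ i\<rfloor> * (\<Sum>j\<in>UNIV. A $ i $ j * c $ j))"
      unfolding sum_distrib_left by (rule sum.swap)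
    also have "\<dots> = 0"
      unfolding c_def by (intro sum.neutral ballI) (simp add: cofactor_vec_orthogonal)
    finally show "(\<Sum>j\<in>UNIV. b' $ j * c $ j) = (\<Sum>j\<in>UNIV. b $ j * c $ j)"
      by (simp add: b'_def left_diff_distrib sum_subtractf sum_distrib_right mult.assoc)
    fix j
    have "real_of_int (b' $ j) = t $ r * cr $ j + (\<Sum>i\<in>UNIV - {r}. frac (t $ i) * real_of_int (A $ i $ j))"
      by (simp add: b'_def b_split frac_def left_diff_distrib sum_subtractf)
    then have "real_of_int \<bar>b' $ j\<bar> \<le> \<bar>t $ r * cr $ j\<bar> + \<bar>\<Sum>i\<in>UNIV - {r}. frac (t $ i) * real_of_int (A $ i $ j)\<bar>"
      using abs_triangle_ineq by simp
    also have "\<bar>t $ r * cr $ j\<bar> \<le> \<bar>t $ r\<bar> * norm cr"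
      unfolding abs_mult by (intro mult_left_mono component_le_norm_cart) simp
    also have "\<bar>t $ r\<bar> * norm cr = \<bar>s\<bar> / norm cr"
      unfolding tr by (simp add: power2_eq_square)
    also have "\<bar>\<Sum>i\<in>UNIV - {r}. frac (t $ i) * real_of_int (A $ i $ j)\<bar>
        \<le> (\<Sum>i\<in>UNIV - {r}. \<bar>frac (t $ i) * real_of_int (A $ i $ j)\<bar>)"
      by (rule sum_abs)
    also have "\<dots> \<le> (\<Sum>i\<in>UNIV - {r}. real_of_int \<bar>A $ i $ j\<bar>)"
    proof (rule sum_mono)
      fix i
      have "\<bar>frac (t $ i)\<bar> * \<bar>real_of_int (A $ i $ j)\<bar> \<le> 1 * \<bar>real_of_int (A $ i $ j)\<bar>"
        using frac_ge_0[of "t $ i"] frac_lt_1[of "t $ i"] by (intro mult_right_mono) auto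
      then show "\<bar>frac (t $ i) * real_of_int (A $ i $ j)\<bar> \<le> real_of_int \<bar>A $ i $ j\<bar>"
        by (simp add: abs_mult)
    qed
    finally show "real_of_int \<bar>b' $ j\<bar> \<le> (\<Sum>i\<in>UNIV - {r}. real_of_int \<bar>A $ i $ j\<bar>) +
      real_of_int \<bar>\<Sum>j\<in>UNIV. b $ j * c $ j\<bar> / norm (\<chi> j. real_of_int (c $ j))"
      unfolding s_def cr_def[symmetric] by simp
  qed
qed

text \<open>The rows lifted through the box have entries at most \<open>q * (K + 1)\<close>. The row
  \<open>r\<close> becomes \<open>x $ r + q b'\<close> with \<open>b'\<close> of about the same
  size, which brings in the second factor \<open>q\<close>.\<close>

lemma exists_SL_lift:
  fixes x :: "int ^ 'n ^ 'n::finite" and q :: int and B K L :: nat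
  assumes q: "q \<ge> 2" and x: "x \<in> SL_over (residue_ring q)"
    and B: "q * (int K + 1) \<le> int B"
    and L: "(3 * CARD('n) * B) ^ (CARD('n) + 1) \<le> 2 ^ L" and K: "90 * L < K"
  shows "\<exists>\<gamma>\<in>SL_int. reduce_mod q \<gamma> = x \<and>
    op_norm \<gamma> \<le> (real CARD('n))\<^sup>2 * ((2 * real CARD('n) + 2) * ((real_of_int q)\<^sup>2 * (real K + 1)))"
proof -
  define n where "n = real CARD('n)"
  define E where "E = (real_of_int q)\<^sup>2 * (real K + 1)"
  have entries: "x $ i $ j \<in> {0..<q}" for i j
    using x q unfolding SL_over_def residue_ring_def by simp
  have red_x: "reduce_mod q x = x"
    using entries by (simp add: reduce_mod_def map_matrix_def vec_eq_iff)
  have det_x: "det x mod q = 1"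
    using x det_over_residue_ring[OF q, of x] unfolding red_x SL_over_def residue_ring_def by simp
  \<comment> \<open>An arbitrary row, kept out of the box lifting and used to correct the
    determinant.\<close>
  obtain r :: 'n where True by simp
  have "UNIV - {r} \<noteq> UNIV" by blast
  from lift_rows[OF q entries det_x B L K this] obtain w
    where "(\<forall>i\<in>UNIV - {r}. w i \<in> int_box K {}) \<and>
      (\<forall>p. prime p \<longrightarrow> indep_mod p (UNIV - {r}) (\<lambda>i j. x $ i $ j + q * w i j))"
    by (rule exE)
  then have w: "\<And>i. i \<noteq> r \<Longrightarrow> w i \<in> int_box K {}"
      "\<And>p. prime p \<Longrightarrow> indep_mod p (UNIV - {r}) (\<lambda>i j. x $ i $ j + q * w i j)"
    by simp_all
  define A where "A = (\<chi> i j. if i = r then x $ r $ j else x $ i $ j + q * w i j)"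
  have Ar: "A $ r $ j = x $ r $ j" for j
    by (simp add: A_def)
  have Ai: "A $ i $ j = x $ i $ j + q * w i j" if "i \<noteq> r" for i j
    using that by (simp add: A_def)
  define c where "c = cofactor_vec r A"
  have c_prime: "\<exists>j\<in>UNIV. \<not> p dvd c $ j" if "prime p" for p
  proof -
    have "indep_mod p (UNIV - {r}) (\<lambda>i j. A $ i $ j)"
      using Ai by (intro indep_mod_cong[OF w(2)[OF that]]) auto
    from not_dvd_cofactor_vec[OF that this] show ?thesis
      unfolding c_def by blast
  qed
  have c0: "c \<noteq> 0"
    using c_prime[of 2] by auto
  obtain b0 where b0: "(\<Sum>j\<in>UNIV. b0 j * c $ j) = 1"
    using bezout_family[OF finite, of UNIV "\<lambda>j. c $ j"] c_prime by blast
  have replace: "replace_row r (A $ r) A = A"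
    by (simp add: replace_row_def vec_eq_iff)
  have det_A: "det A = (\<Sum>j\<in>UNIV. x $ r $ j * c $ j)"
    using det_replace_row[of r "A $ r" A] unfolding replace c_def by (simp add: Ar)
  have red_A: "reduce_mod q A = x"
    using entries by (simp add: reduce_mod_def map_matrix_def vec_eq_iff A_def)
  then have "det A mod q = 1 mod q"
    using det_cong_mod[OF q, of A x] red_x det_x q by simp
  then have "q dvd 1 - det A"
    by (metis mod_eq_dvd_iff)
  \<comment> \<open>The correction must have inner product exactly \<open>m\<close> with
    \<open>c\<close> to make the determinant 1.\<close>
  then obtain m where m: "1 - det A = q * m" ..
  define b where "b = (\<chi> j. m * b0 j)"
  have "(\<Sum>j\<in>UNIV. b $ j * c $ j) = m * (\<Sum>j\<in>UNIV. b0 j * c $ j)"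
    by (simp add: b_def sum_distrib_left mult.assoc)
  then have bc: "(\<Sum>j\<in>UNIV. b $ j * c $ j) = m"
    using b0 by simp
  let ?c = "\<chi> j. real_of_int (c $ j)"
  obtain b' :: "int ^ 'n" where b': "(\<Sum>j\<in>UNIV. b' $ j * c $ j) = m"
      "\<And>j. real_of_int \<bar>b' $ j\<bar> \<le> (\<Sum>i\<in>UNIV - {r}. real_of_int \<bar>A $ i $ j\<bar>) + real_of_int \<bar>m\<bar> / norm ?c"
    by (rule reduce_vec_mod_rows[OF c0[unfolded c_def], of b, folded c_def, unfolded bc]) (rule that)
  have qE: "real_of_int q \<le> E" "real_of_int q * (real_of_int q * (real K + 1)) = E" "real_of_int q * (real K + 1) \<le> E"
  proof -
    show eq: "real_of_int q * (real_of_int q * (real K + 1)) = E"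
      by (simp add: E_def power2_eq_square)
    have "1 * (real_of_int q * (real K + 1)) \<le> real_of_int q * (real_of_int q * (real K + 1))"
      using q by (intro mult_right_mono) auto
    then show le: "real_of_int q * (real K + 1) \<le> E"
      unfolding eq by simp
    have "real_of_int q * 1 \<le> real_of_int q * (real K + 1)"
      using q by (intro mult_left_mono) auto
    with le show "real_of_int q \<le> E" by simp
  qed
  have Abound: "real_of_int \<bar>A $ i $ j\<bar> \<le> real_of_int q * (real K + 1)" if "i \<noteq> r" for i j
  proof -
    have "w i j \<in> {0..<int K}"
      using w(1)[OF that] unfolding mem_int_box_iff by simp
    then have "0 \<le> q * w i j" "q * w i j \<le> q * int K"
      using q by simp_all
    moreover have "0 \<le> x $ i $ j" "x $ i $ j < q"
      using entries[of i j] by simp_all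
    ultimately have "\<bar>A $ i $ j\<bar> \<le> q * (int K + 1)"
      unfolding Ai[OF that] distrib_left by linarith
    then have "real_of_int \<bar>A $ i $ j\<bar> \<le> real_of_int (q * (int K + 1))"
      by (rule of_int_le_iff[THEN iffD2])
    then show ?thesis by simp
  qed
  have norm_c: "norm ?c \<ge> 1"
  proof -
    obtain j where "c $ j \<noteq> 0"
      using c0 by (auto simp: vec_eq_iff)
    then have "1 \<le> \<bar>c $ j\<bar>" by linarith
    then have "1 \<le> \<bar>?c $ j\<bar>" by simp
    also have "\<dots> \<le> norm ?c"
      by (rule component_le_norm_cart)
    finally show ?thesis .
  qed
  \<comment> \<open>As an inner product with \<open>c\<close>, the determinant is bounded by a
    multiple of \<open>norm ?c\<close>. This factor cancels in
    \<open>\<bar>m\<bar> / norm ?c\<close>, so the component along \<open>c\<close> is bounded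
    independently of \<open>q\<close> and \<open>K\<close>.\<close>
  have "\<bar>real_of_int (det A)\<bar> \<le> n * real_of_int q * norm ?c"
  proof -
    have "real_of_int (det A) = (\<Sum>j\<in>UNIV. real_of_int (x $ r $ j) * ?c $ j)"
      by (simp add: det_A)
    then have "\<bar>real_of_int (det A)\<bar> \<le> (\<Sum>j\<in>UNIV. \<bar>real_of_int (x $ r $ j) * ?c $ j\<bar>)"
      by (simp add: sum_abs)
    also have "\<dots> \<le> (\<Sum>j\<in>(UNIV :: 'n set). real_of_int q * norm ?c)"
    proof (rule sum_mono)
      fix j
      have "\<bar>real_of_int (x $ r $ j)\<bar> \<le> real_of_int q"
        using entries[of r j] by simp
      then show "\<bar>real_of_int (x $ r $ j) * ?c $ j\<bar> \<le> real_of_int q * norm ?c"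
        unfolding abs_mult by (intro mult_mono component_le_norm_cart) auto
    qed
    finally show ?thesis
      by (simp add: n_def)
  qed
  moreover have "real_of_int q * real_of_int m = 1 - real_of_int (det A)"
    using arg_cong[OF m, of real_of_int] by simp
  then have "real_of_int q * \<bar>real_of_int m\<bar> = \<bar>1 - real_of_int (det A)\<bar>"
    using q by (metis abs_mult abs_of_nonneg of_int_0_le_iff order_trans zero_le_numeral)
  ultimately have "real_of_int q * \<bar>real_of_int m\<bar> \<le> 1 + n * real_of_int q * norm ?c"
    by linarith
  also have "\<dots> \<le> real_of_int q * norm ?c + n * real_of_int q * norm ?c"
    using mult_mono[of 1 "real_of_int q" 1 "norm ?c"] norm_c q by simp
  also have "\<dots> = real_of_int q * ((1 + n) * norm ?c)"
    by (simp add: algebra_simps)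
  finally have "\<bar>real_of_int m\<bar> \<le> (1 + n) * norm ?c"
    using q by simp
  then have m_bound: "real_of_int \<bar>m\<bar> / norm ?c \<le> 1 + n"
    using norm_c by (subst pos_divide_le_eq) auto
  define \<gamma> where "\<gamma> = replace_row r (\<chi> j. x $ r $ j + q * b' $ j) A"
  have "det \<gamma> = det A + q * (\<Sum>j\<in>UNIV. b' $ j * c $ j)"
    unfolding \<gamma>_def det_replace_row det_A c_def[symmetric]
    by (simp add: distrib_right sum.distrib sum_distrib_left mult.assoc)
  then have "\<gamma> \<in> SL_int"
    using m b'(1) by (simp add: SL_int_def)
  moreover have "reduce_mod q \<gamma> = x"
    using red_A entries by (simp add: reduce_mod_def map_matrix_def vec_eq_iff \<gamma>_def replace_row_def)
  moreover have "op_norm \<gamma> \<le> n\<^sup>2 * ((2 * n + 2) * E)"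
  proof -
    have n1: "n \<ge> 1"
      by (simp add: n_def Suc_leI)
    have E0: "E \<ge> 0"
      by (simp add: E_def)
    \<comment> \<open>In row \<open>r\<close> the other rows contribute \<open>n * E\<close>, the
      component along \<open>c\<close> contributes \<open>(1 + n) * E\<close>, and the entry of
      \<open>x\<close> a further \<open>E\<close>.\<close>
    have "\<bar>map_matrix real_of_int \<gamma> $ i $ j\<bar> \<le> (2 * n + 2) * E" for i j
    proof (cases "i = r")
      case True
      have "(\<Sum>i\<in>UNIV - {r}. real_of_int \<bar>A $ i $ j\<bar>) \<le> (\<Sum>i\<in>UNIV - {r}. real_of_int q * (real K + 1))"
        using Abound by (intro sum_mono) auto
      also have "\<dots> = real (card (UNIV - {r})) * (real_of_int q * (real K + 1))"
        by simp
      also have "\<dots> \<le> n * (real_of_int q * (real K + 1))"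
        unfolding n_def using q by (intro mult_right_mono of_nat_mono card_mono) auto
      finally have "real_of_int \<bar>b' $ j\<bar> \<le> n * (real_of_int q * (real K + 1)) + (1 + n)"
        using b'(2)[of j] m_bound by linarith
      then have "real_of_int q * real_of_int \<bar>b' $ j\<bar> \<le> real_of_int q * (n * (real_of_int q * (real K + 1)) + (1 + n))"
        using q by (intro mult_left_mono) auto
      also have "\<dots> = n * E + (1 + n) * real_of_int q"
        unfolding qE(2)[symmetric] by (simp add: algebra_simps)
      also have "\<dots> \<le> n * E + (1 + n) * E"
        using qE(1) n1 by (intro add_left_mono mult_left_mono) auto
      finally have "real_of_int q * real_of_int \<bar>b' $ j\<bar> \<le> (2 * n + 1) * E"
        by (simp add: algebra_simps)
      moreover have "\<bar>real_of_int (x $ r $ j)\<bar> \<le> E"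
        using entries[of r j] qE(1) by simp
      moreover have "\<bar>map_matrix real_of_int \<gamma> $ i $ j\<bar> \<le> \<bar>real_of_int (x $ r $ j)\<bar> + real_of_int q * real_of_int \<bar>b' $ j\<bar>"
        using abs_triangle_ineq[of "real_of_int (x $ r $ j)" "real_of_int (q * b' $ j)"] q True
        by (simp add: \<gamma>_def replace_row_def map_matrix_def abs_mult)
      ultimately show ?thesis
        by (simp add: algebra_simps)
    next
      case False
      have "\<bar>map_matrix real_of_int \<gamma> $ i $ j\<bar> = real_of_int \<bar>A $ i $ j\<bar>"
        using False by (simp add: \<gamma>_def replace_row_def map_matrix_def)
      also have "\<dots> \<le> E"
        using Abound[OF False] qE(3) by (rule order_trans)
      also have "\<dots> \<le> (2 * n + 2) * E"
        using n1 E0 mult_right_mono[of 1 "2 * n + 2" E] by simp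
      finally show ?thesis .
    qed
    then have "op_norm \<gamma> \<le> real CARD('n) * real CARD('n) * ((2 * n + 2) * E)"
      unfolding op_norm_def by (rule onorm_le_matrix_component)
    then show ?thesis
      by (simp add: n_def power2_eq_square)
  qed
  ultimately show ?thesis
    unfolding n_def E_def by blast
qed

section \<open>Choice of the parameters\<close>

lemma exists_lift_parameters:
  fixes n :: nat
  assumes "n \<ge> 1"
  shows "\<exists>C :: real. \<forall>q :: int. q \<ge> 2 \<longrightarrow> (\<exists>K L B :: nat. q * (int K + 1) \<le> int B \<and>
    (3 * n * B) ^ (n + 1) \<le> 2 ^ L \<and> 90 * L < K \<and> real K + 1 \<le> C * ln (real_of_int q))"
proof -
  \<comment> \<open>\<open>K\<close> must exceed a multiple of \<open>log (q K)\<close>, so its factor \<open>c\<close> appears on both sides;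
    \<open>a\<close> is chosen to make \<open>6 n c \<le> a (a + 1) \<le> 4 ^ a\<close>.\<close>
  define a where "a = 1086 * n * (n + 1)"
  define e where "e = 2 * a"
  define c where "c = 90 * (n + 1) * (e + 2) + 1"
  \<comment> \<open>Here \<open>c = 180 * (n + 1) * (a + 1) + 1\<close>, so 181 absorbs the final 1,
    and 1086 is 6 times 181.\<close>
  have "1 \<le> (n + 1) * (a + 1)" by simp
  then have "c \<le> 181 * ((n + 1) * (a + 1))"
    unfolding c_def e_def by (simp add: algebra_simps)
  then have "6 * n * c \<le> 6 * n * (181 * ((n + 1) * (a + 1)))"
    by (rule mult_le_mono2)
  also have "\<dots> = 1086 * n * (n + 1) * (a + 1)"
  proof -
    have "6 * n * (181 * (u * v)) = 1086 * n * u * v" for u v :: nat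
      by simp
    then show ?thesis .
  qed
  also have "\<dots> = a * (a + 1)"
    by (simp only: a_def[symmetric])
  also have "\<dots> \<le> 2 ^ a * 2 ^ a"
    using Suc_leI[OF less_exp[of a]] by (intro mult_le_mono) auto
  also have "\<dots> = 2 ^ e"
    by (simp add: e_def mult_2 power_add)
  finally have c_le: "6 * n * c \<le> 2 ^ e" .
  have c1: "c \<ge> 1"
    by (simp add: c_def)
  show ?thesis
  proof (intro exI[of _ "4 * real c / ln 2"] allI impI)
    fix q :: int assume q: "q \<ge> 2"
    define l where "l = nat \<lceil>log 2 (real_of_int q)\<rceil>"
    have log1: "log 2 (real_of_int q) \<ge> 1"
      using q by (simp add: le_log_iff)
    have l: "real l \<ge> log 2 (real_of_int q)" "real l \<le> log 2 (real_of_int q) + 1"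
      using log1 unfolding l_def by linarith+
    have l1: "l \<ge> 1"
      using l(1) log1 by linarith
    have "real_of_int q = 2 powr log 2 (real_of_int q)"
      using q by simp
    also have "\<dots> \<le> 2 powr real l"
      using l(1) by (intro powr_mono) auto
    also have "\<dots> = real_of_int (2 ^ l)"
      by (simp add: powr_realpow)
    finally have ql: "q \<le> 2 ^ l"
      by (rule of_int_le_iff[THEN iffD1])
    then have ql: "nat q \<le> 2 ^ l"
      by (simp add: nat_le_iff)
    define K where "K = c * l"
    define B where "B = nat q * (K + 1)"
    \<comment> \<open>In the exponent \<open>e + 2 * l\<close>, one \<open>l\<close> comes from
      \<open>q \<le> 2 ^ l\<close>, the other from the factor \<open>l < 2 ^ l\<close> of
      \<open>K\<close>, and \<open>e\<close> from the constants \<open>6 * n * c\<close>.\<close>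
    define L where "L = (e + 2 * l) * (n + 1)"
    have cl1: "1 \<le> c * l"
      using c1 l1 mult_le_mono[of 1 c 1 l] by simp
    have "3 * n * B = 3 * n * (nat q * (c * l + 1))"
      by (simp add: B_def K_def)
    also have "\<dots> \<le> 3 * n * (2 ^ l * (2 * (c * l)))"
      using cl1 ql by (intro mult_le_mono) auto
    also have "\<dots> = 6 * n * c * (2 ^ l * l)"
      by simp
    also have "\<dots> \<le> 2 ^ e * (2 ^ l * 2 ^ l)"
      using c_le less_exp[of l] by (intro mult_le_mono) auto
    also have "\<dots> = 2 ^ (e + 2 * l)"
      by (simp add: power_add mult_2)
    finally have "(3 * n * B) ^ (n + 1) \<le> (2 ^ (e + 2 * l)) ^ (n + 1)"
      by (rule power_mono) simp
    then have bnd: "(3 * n * B) ^ (n + 1) \<le> 2 ^ L"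
      unfolding L_def by (simp only: power_mult)
    have "e + 2 * l \<le> (e + 2) * l"
      using mult_le_mono2[OF l1, of e] by (simp add: algebra_simps)
    then have "90 * L \<le> 90 * ((e + 2) * l * (n + 1))"
      unfolding L_def by (intro mult_le_mono) auto
    \<comment> \<open>The final 1 in \<open>c\<close> makes this strict.\<close>
    also have "\<dots> < K"
      unfolding K_def c_def using l1 by (simp add: algebra_simps)
    finally have LK: "90 * L < K" .
    \<comment> \<open>One factor 2 absorbs the \<open>+ 1\<close>, another the rounding up in
      \<open>l\<close>, and \<open>ln 2\<close> converts from binary logarithms.\<close>
    have "real K + 1 \<le> 2 * (real c * real l)"
      using cl1 unfolding K_def by (simp flip: of_nat_mult)
    also have "\<dots> \<le> 2 * (real c * (2 * log 2 (real_of_int q)))"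
      using l(2) log1 by (intro mult_left_mono) auto
    also have "\<dots> = 4 * real c / ln 2 * ln (real_of_int q)"
      by (simp add: log_def)
    finally have "real K + 1 \<le> 4 * real c / ln 2 * ln (real_of_int q)" .
    moreover have "q * (int K + 1) \<le> int B"
      using q by (simp add: B_def algebra_simps)
    ultimately show "\<exists>K L B :: nat. q * (int K + 1) \<le> int B \<and>
        (3 * n * B) ^ (n + 1) \<le> 2 ^ L \<and> 90 * L < K \<and> real K + 1 \<le> 4 * real c / ln 2 * ln (real_of_int q)"
      using bnd LK by blast
  qed
qed

theorem theorem1p3:
  assumes "CARD('n::finite) \<ge> 2"
  shows "\<exists>C :: real. \<forall>q :: int. q \<ge> 2 \<longrightarrow>
    (\<forall>x \<in> (SL_over (residue_ring q) :: (int ^ 'n ^ 'n) set).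
      \<exists>\<gamma> \<in> SL_int. reduce_mod q \<gamma> = x \<and>
        op_norm \<gamma> \<le> C * (real_of_int q)\<^sup>2 * ln (real_of_int q))"
proof -
  let ?n = "real CARD('n)"
  obtain C where C: "\<And>q :: int. q \<ge> 2 \<Longrightarrow> \<exists>K L B :: nat. q * (int K + 1) \<le> int B \<and>
      (3 * CARD('n) * B) ^ (CARD('n) + 1) \<le> 2 ^ L \<and> 90 * L < K \<and> real K + 1 \<le> C * ln (real_of_int q)"
  proof -
    have "CARD('n) \<ge> 1"
      using assms by linarith
    from exists_lift_parameters[OF this] show thesis
      using that by blast
  qed
  show ?thesis
  proof (intro exI[of _ "?n\<^sup>2 * (2 * ?n + 2) * C"] allI impI ballI)
    fix q :: int and x :: "int ^ 'n ^ 'n"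
    assume q: "q \<ge> 2" and x: "x \<in> SL_over (residue_ring q)"
    obtain K L B where par: "q * (int K + 1) \<le> int B" "(3 * CARD('n) * B) ^ (CARD('n) + 1) \<le> 2 ^ L"
        "90 * L < K" and K: "real K + 1 \<le> C * ln (real_of_int q)"
      using C[OF q] by blast
    obtain \<gamma> where \<gamma>: "\<gamma> \<in> SL_int" "reduce_mod q \<gamma> = x"
        "op_norm \<gamma> \<le> ?n\<^sup>2 * ((2 * ?n + 2) * ((real_of_int q)\<^sup>2 * (real K + 1)))"
      using exists_SL_lift[OF q x par] by blast
    have "?n\<^sup>2 * ((2 * ?n + 2) * ((real_of_int q)\<^sup>2 * (real K + 1)))
        \<le> ?n\<^sup>2 * ((2 * ?n + 2) * ((real_of_int q)\<^sup>2 * (C * ln (real_of_int q))))"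
      using K by (intro mult_left_mono) auto
    also have "\<dots> = ?n\<^sup>2 * (2 * ?n + 2) * C * (real_of_int q)\<^sup>2 * ln (real_of_int q)"
      by (simp only: mult_ac)
    finally show "\<exists>\<gamma>\<in>SL_int. reduce_mod q \<gamma> = x \<and>
        op_norm \<gamma> \<le> ?n\<^sup>2 * (2 * ?n + 2) * C * (real_of_int q)\<^sup>2 * ln (real_of_int q)"
      by (intro bexI[of _ \<gamma>] conjI \<gamma>(1,2) order_trans[OF \<gamma>(3)])
  qed
qed

end
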